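(* The following statement is false: for every complete quotient map $q:E\twoheadrightarrow F$ between Banach operator spaces, every finite-dimensional subspace $F_0\subseteq F$ and every $\varepsilon>0$, there exists a finite-dimensional subspace $E_0\subseteq E$ such that $q(E_0)=F_0$ and for every $n$ and every $y\in M_n(F_0)$ there exists $x\in M_n(E_0)$ with $q_n(x)=y$ and $\|x\|_{M_n(E_0)}\le(1+\varepsilon)\|y\|_{M_n(F_0)}$.
   Context: A Banach operator space is a complete operator space (norms on all matrix levels $M_n(E)$ satisfying Ruan's axioms). A linear map $q:E\to F$ is a complete quotient if it is onto and the induced map $E/\ker q\to F$ is a completely isometric isomorphism; $q_n$ denotes its $n$-th amplification acting entrywise on matrices. *)

theory Defs
  imports Complex_Main
begin

text \<open>Ambient complex vector space: V = (nat => complex) with pointwise operations.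
  Every complex vector space of Hamel dimension at most the continuum is linearly
  isomorphic to a subspace of V.\<close>

type_synonym vec = "nat \<Rightarrow> complex"

definition vzero :: vec where "vzero = (\<lambda>k. 0)"
definition vadd :: "vec \<Rightarrow> vec \<Rightarrow> vec" where "vadd u v = (\<lambda>k. u k + v k)"
definition vsmul :: "complex \<Rightarrow> vec \<Rightarrow> vec" where "vsmul c v = (\<lambda>k. c * v k)"

definition csubsp :: "vec set \<Rightarrow> bool" where
  "csubsp S \<longleftrightarrow> vzero \<in> S \<and> (\<forall>u\<in>S. \<forall>v\<in>S. vadd u v \<in> S) \<and> (\<forall>c. \<forall>v\<in>S. vsmul c v \<in> S)"

definition vsum :: "('i \<Rightarrow> vec) \<Rightarrow> 'i set \<Rightarrow> vec" where
  "vsum f I = (\<lambda>k. \<Sum>i\<in>I. f i k)"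

definition cspan :: "vec set \<Rightarrow> vec set" where
  "cspan S = {v. \<exists>T c. finite T \<and> T \<subseteq> S \<and> v = vsum (\<lambda>s. vsmul (c s) s) T}"

definition fin_dim :: "vec set \<Rightarrow> bool" where
  "fin_dim S \<longleftrightarrow> (\<exists>B. finite B \<and> S = cspan B)"

definition clinear_on :: "vec set \<Rightarrow> (vec \<Rightarrow> vec) \<Rightarrow> bool" where
  "clinear_on S q \<longleftrightarrow> (\<forall>u\<in>S. \<forall>v\<in>S. q (vadd u v) = vadd (q u) (q v)) \<and>
                      (\<forall>c. \<forall>v\<in>S. q (vsmul c v) = vsmul c (q v))"

type_synonym 'a mat = "nat \<Rightarrow> nat \<Rightarrow> 'a"

definition matset :: "vec set \<Rightarrow> nat \<Rightarrow> nat \<Rightarrow> vec mat set" where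
  "matset S m n = {x. (\<forall>i j. i < m \<and> j < n \<longrightarrow> x i j \<in> S) \<and>
                       (\<forall>i j. \<not> (i < m \<and> j < n) \<longrightarrow> x i j = vzero)}"

definition cmatset :: "nat \<Rightarrow> nat \<Rightarrow> complex mat set" where
  "cmatset m n = {a. \<forall>i j. \<not> (i < m \<and> j < n) \<longrightarrow> a i j = 0}"

definition cmat_norm :: "nat \<Rightarrow> nat \<Rightarrow> complex mat \<Rightarrow> real" where
  "cmat_norm m n a = (SUP v \<in> {v. (\<Sum>j<n. (cmod (v j))\<^sup>2) \<le> 1}.
                        sqrt (\<Sum>i<m. (cmod (\<Sum>j<n. a i j * v j))\<^sup>2))"

definition madd :: "vec mat \<Rightarrow> vec mat \<Rightarrow> vec mat" where
  "madd x y = (\<lambda>i j. vadd (x i j) (y i j))"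

definition msmul :: "complex \<Rightarrow> vec mat \<Rightarrow> vec mat" where
  "msmul c x = (\<lambda>i j. vsmul c (x i j))"

definition triple_prod :: "nat \<Rightarrow> complex mat \<Rightarrow> vec mat \<Rightarrow> complex mat \<Rightarrow> vec mat" where
  "triple_prod n a x b = (\<lambda>i l. vsum (\<lambda>(j,k). vsmul (a i j * b k l) (x j k)) ({..<n} \<times> {..<n}))"

definition dsum :: "nat \<Rightarrow> vec mat \<Rightarrow> vec mat \<Rightarrow> vec mat" where
  "dsum m x y = (\<lambda>i j. if i < m \<and> j < m then x i j
                       else if m \<le> i \<and> m \<le> j then y (i - m) (j - m) else vzero)"

text \<open>Operator space (Ruan's axioms): N n is a norm on M_n(E) for every n >= 1, and
  (R1) ||a x b|| <= ||a|| ||x|| ||b||, (R2) ||x (+) y|| = max ||x|| ||y||.\<close>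
definition operator_space :: "vec set \<Rightarrow> (nat \<Rightarrow> vec mat \<Rightarrow> real) \<Rightarrow> bool" where
  "operator_space E N \<longleftrightarrow> csubsp E \<and>
     (\<forall>n\<ge>1. \<forall>x\<in>matset E n n. 0 \<le> N n x \<and> (N n x = 0 \<longleftrightarrow> x = (\<lambda>i j. vzero))) \<and>
     (\<forall>n\<ge>1. \<forall>x\<in>matset E n n. \<forall>y\<in>matset E n n. N n (madd x y) \<le> N n x + N n y) \<and>
     (\<forall>n\<ge>1. \<forall>c. \<forall>x\<in>matset E n n. N n (msmul c x) = cmod c * N n x) \<and>
     (\<forall>m\<ge>1. \<forall>n\<ge>1. \<forall>a\<in>cmatset m n. \<forall>x\<in>matset E n n. \<forall>b\<in>cmatset n m.
        N m (triple_prod n a x b) \<le> cmat_norm m n a * N n x * cmat_norm n m b) \<and>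
     (\<forall>m\<ge>1. \<forall>n\<ge>1. \<forall>x\<in>matset E m m. \<forall>y\<in>matset E n n.
        N (m + n) (dsum m x y) = max (N m x) (N n y))"

definition e11 :: "vec \<Rightarrow> vec mat" where
  "e11 v = (\<lambda>i j. if i = 0 \<and> j = 0 then v else vzero)"

definition vdiff :: "vec \<Rightarrow> vec \<Rightarrow> vec" where "vdiff u v = vadd u (vsmul (-1) v)"

definition banach_operator_space :: "vec set \<Rightarrow> (nat \<Rightarrow> vec mat \<Rightarrow> real) \<Rightarrow> bool" where
  "banach_operator_space E N \<longleftrightarrow> operator_space E N \<and>
     (\<forall>s. (\<forall>k. s k \<in> E) \<and>
          (\<forall>e>0. \<exists>K. \<forall>k\<ge>K. \<forall>l\<ge>K. N 1 (e11 (vdiff (s k) (s l))) < e)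
        \<longrightarrow> (\<exists>v\<in>E. (\<lambda>k. N 1 (e11 (vdiff (s k) v))) \<longlonglongrightarrow> 0))"

definition amp :: "(vec \<Rightarrow> vec) \<Rightarrow> nat \<Rightarrow> vec mat \<Rightarrow> vec mat" where
  "amp q n x = (\<lambda>i j. if i < n \<and> j < n then q (x i j) else vzero)"

text \<open>Complete quotient: q linear and onto, and the induced map E/ker q -> F is a
  complete isometry, i.e. for every n and x in M_n(E), ||q_n x||_n equals the quotient
  norm of the class of x in M_n(E/ker q) = M_n(E)/M_n(ker q).\<close>
definition complete_quotient ::
  "vec set \<Rightarrow> (nat \<Rightarrow> vec mat \<Rightarrow> real) \<Rightarrow> vec set \<Rightarrow> (nat \<Rightarrow> vec mat \<Rightarrow> real) \<Rightarrow> (vec \<Rightarrow> vec) \<Rightarrow> bool"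
  where
  "complete_quotient E NE F NF q \<longleftrightarrow> clinear_on E q \<and> q ` E = F \<and>
     (\<forall>n\<ge>1. \<forall>x\<in>matset E n n.
        NF n (amp q n x) = Inf {NE n (madd x k) | k. k \<in> matset {v \<in> E. q v = vzero} n n})"

end

theory Submission
  imports Defs "HOL-Analysis.L2_Norm"
begin

text \<open>
  The counterexample comes from unitaries whose tensor products have a uniform spectral gap.
  For each \<open>k\<close>, five unitaries \<open>a\<^sub>0\<^sup>k, \<dots>, a\<^sub>4\<^sup>k\<close> act on functions on the points of exact order
  \<open>2^(k+1)\<close> of the two-dimensional torus: the identity, the two coordinate characters and the two
  elementary shears. For \<open>k > l\<close> the norm of \<open>\<Sum>\<^sub>c a\<^sub>c\<^sup>k \<otimes> cnj a\<^sub>c\<^sup>l\<close> is at most \<open>5 - \<delta>\<close> with \<open>\<delta> > 0\<close>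
  independent of \<open>k\<close> and \<open>l\<close>: an almost invariant vector would give a measure on the torus without
  mass at \<open>0\<close> that is concentrated near \<open>0\<close> and almost invariant under the shears. For \<open>k = l\<close> the
  norm is \<open>5\<close>.

  Let \<open>E\<close> be the space of convergent sequences \<open>(s\<^sub>k)\<close> in \<open>\<complex>\<^sup>5\<close>, normed by the supremum of the norms of
  the coordinates of \<open>s\<^sub>k\<close> and of \<open>\<Sum>\<^sub>c a\<^sub>c\<^sup>k \<otimes> s\<^bsub>k,c\<^esub>\<close>, and let \<open>q\<close> be the limit. Replacing initial terms
  by \<open>0\<close> shows that the quotient norm of \<open>y\<close> is the limsup over \<open>k\<close> of these quantities for
  \<open>s\<^sub>k = y\<close>. On a finite-dimensional \<open>E\<^sub>0\<close> the convergence is uniform over all matrix levels, so for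
  large \<open>l\<close> a lift of \<open>y\<^sub>c = cnj a\<^sub>c\<^sup>l\<close> to \<open>E\<^sub>0\<close> has norm almost at least \<open>5\<close>, while \<open>y\<close> has norm at most
  \<open>5 - \<delta>\<close>.
\<close>

section \<open>Operator norms of finite matrices\<close>

abbreviation l2 :: "('i \<Rightarrow> complex) \<Rightarrow> 'i set \<Rightarrow> real" where
  "l2 v I \<equiv> L2_set (\<lambda>i. cmod (v i)) I"

definition act :: "'j set \<Rightarrow> ('i \<Rightarrow> 'j \<Rightarrow> complex) \<Rightarrow> ('j \<Rightarrow> complex) \<Rightarrow> 'i \<Rightarrow> complex" where
  "act J T v = (\<lambda>i. \<Sum>j\<in>J. T i j * v j)"

text \<open>Index sets are arbitrary, so that an \<open>n\<close> by \<open>n\<close> matrix over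
  operators on functions on \<open>S\<close> can be indexed by \<open>{..<n} \<times> S\<close>;
  \<open>cmat_norm\<close> is the case of initial segments.\<close>

definition op_norm :: "'i set \<Rightarrow> 'j set \<Rightarrow> ('i \<Rightarrow> 'j \<Rightarrow> complex) \<Rightarrow> real" where
  "op_norm I J T = (SUP v \<in> {v. l2 v J \<le> 1}. l2 (act J T v) I)"

lemma cmat_norm_eq_op_norm: "cmat_norm m n a = op_norm {..<m} {..<n} a"
  by (simp add: cmat_norm_def op_norm_def act_def L2_set_def)

lemma l2_add_le: "l2 (\<lambda>i. u i + v i) I \<le> l2 u I + l2 v I"
proof -
  have "l2 (\<lambda>i. u i + v i) I \<le> L2_set (\<lambda>i. cmod (u i) + cmod (v i)) I"
    by (intro L2_set_mono) (auto simp: norm_triangle_ineq)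
  also have "\<dots> \<le> l2 u I + l2 v I"
    by (rule L2_set_triangle_ineq)
  finally show ?thesis .
qed

lemma l2_scale: "l2 (\<lambda>i. c * u i) I = cmod c * l2 u I"
  by (simp add: norm_mult L2_set_right_distrib)

lemma l2_sum_le:
  assumes "finite C"
  shows "l2 (\<lambda>i. \<Sum>c\<in>C. u c i) I \<le> (\<Sum>c\<in>C. l2 (u c) I)"
  using assms
proof (induction C rule: finite_induct)
  case (insert c C)
  have "l2 (\<lambda>i. u c i + (\<Sum>c\<in>C. u c i)) I \<le> l2 (u c) I + l2 (\<lambda>i. \<Sum>c\<in>C. u c i) I"
    by (rule l2_add_le)
  then show ?case using insert by simp
qed (simp add: L2_set_def)

lemma cmod_sum_mult_le_l2: "cmod (\<Sum>i\<in>I. u i * v i) \<le> l2 u I * l2 v I"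
proof -
  have "cmod (\<Sum>i\<in>I. u i * v i) \<le> (\<Sum>i\<in>I. cmod (u i) * cmod (v i))"
    by (rule order_trans[OF norm_sum]) (simp add: norm_mult)
  also have "\<dots> \<le> l2 u I * l2 v I"
    using L2_set_mult_ineq[of "\<lambda>i. cmod (u i)" "\<lambda>i. cmod (v i)" I] by simp
  finally show ?thesis .
qed

lemma act_scale: "act J T (\<lambda>j. c * v j) i = c * act J T v i"
  by (simp add: act_def sum_distrib_left mult_ac)

text \<open>A real \<open>SUP\<close> carries information only over a bounded set. The sum of the
  moduli of all entries is a crude bound, since every coordinate of \<open>v\<close> in
  \<open>J\<close> has modulus at most \<open>1\<close>.\<close>

lemma op_norm_bdd_above:
  assumes "finite I" "finite J"
  shows "bdd_above ((\<lambda>v. l2 (act J T v) I) ` {v. l2 v J \<le> 1})"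
proof (rule bdd_aboveI2)
  fix v :: "'b \<Rightarrow> complex" assume v: "v \<in> {v. l2 v J \<le> 1}"
  have "cmod (v j) \<le> 1" if "j \<in> J" for j
    using v member_le_L2_set[OF assms(2) that, of "\<lambda>j. cmod (v j)"] by auto
  then have "cmod (act J T v i) \<le> (\<Sum>j\<in>J. cmod (T i j))" for i
    unfolding act_def
    by (intro order_trans[OF norm_sum] sum_mono) (auto simp: norm_mult mult_left_le)
  then have "(\<Sum>i\<in>I. cmod (act J T v i)) \<le> (\<Sum>i\<in>I. \<Sum>j\<in>J. cmod (T i j))"
    by (intro sum_mono)
  moreover have "l2 (act J T v) I \<le> (\<Sum>i\<in>I. cmod (act J T v i))"
    by (rule L2_set_le_sum) auto
  ultimately show "l2 (act J T v) I \<le> (\<Sum>i\<in>I. \<Sum>j\<in>J. cmod (T i j))"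
    by linarith
qed

lemma op_norm_nonneg:
  assumes "finite I" "finite J"
  shows "0 \<le> op_norm I J T"
proof -
  have "l2 (act J T (\<lambda>_. 0)) I \<le> op_norm I J T"
    unfolding op_norm_def by (rule cSUP_upper[OF _ op_norm_bdd_above]) (auto simp: assms L2_set_def)
  then show ?thesis using L2_set_nonneg order_trans by blast
qed

lemma l2_act_le_op_norm:
  assumes "finite I" "finite J"
  shows "l2 (act J T v) I \<le> op_norm I J T * l2 v J"
proof (cases "l2 v J = 0")
  case True
  then have "v j = 0" if "j \<in> J" for j
    using that assms by (simp add: L2_set_eq_0_iff)
  then have "act J T v = (\<lambda>_. 0)" by (simp add: act_def)
  then show ?thesis using True by (simp add: L2_set_def)
next
  case False
  then have pos: "l2 v J > 0" using L2_set_nonneg[of "\<lambda>i. cmod (v i)" J] by linarith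
  let ?c = "complex_of_real (1 / l2 v J)"
  have "l2 (act J T (\<lambda>j. ?c * v j)) I \<le> op_norm I J T"
    unfolding op_norm_def
  proof (rule cSUP_upper[OF _ op_norm_bdd_above[OF assms]])
    have "l2 (\<lambda>j. ?c * v j) J = 1" unfolding l2_scale using pos by (simp add: norm_divide)
    then show "(\<lambda>j. ?c * v j) \<in> {v. l2 v J \<le> 1}" by simp
  qed
  moreover have "l2 (act J T (\<lambda>j. ?c * v j)) I = l2 (act J T v) I / l2 v J"
    unfolding act_scale l2_scale using pos by (simp add: norm_divide)
  ultimately have "l2 (act J T v) I / l2 v J \<le> op_norm I J T" by simp
  then show ?thesis using pos by (simp add: pos_divide_le_eq)
qed

lemma op_norm_le:
  assumes "0 \<le> C" "\<And>v. l2 (act J T v) I \<le> C * l2 v J"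
  shows "op_norm I J T \<le> C"
  unfolding op_norm_def
proof (rule cSUP_least)
  show "{v :: 'a \<Rightarrow> complex. l2 v J \<le> 1} \<noteq> {}"
    by (auto intro!: exI[of _ "\<lambda>_. 0"] simp: L2_set_def)
  fix v assume "v \<in> {v. l2 v J \<le> 1}"
  then have "C * l2 v J \<le> C * 1" using assms(1) by (intro mult_left_mono) auto
  then show "l2 (act J T v) I \<le> C" using assms(2)[of v] by linarith
qed

lemma cmod_entry_le_op_norm:
  assumes "finite I" "finite J" "i \<in> I" "j \<in> J"
  shows "cmod (T i j) \<le> op_norm I J T"
proof -
  let ?v = "\<lambda>k. if k = j then 1 else 0 :: complex"
  have "act J T ?v i = T i j" using assms by (simp add: act_def if_distrib cong: if_cong)
  moreover have "cmod (act J T ?v i) \<le> l2 (act J T ?v) I"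
    using assms by (intro member_le_L2_set) auto
  moreover have "l2 ?v J = 1"
    using assms by (simp add: L2_set_def if_distrib[of cmod] if_distrib[of "\<lambda>x. x\<^sup>2"] cong: if_cong)
  ultimately show ?thesis using l2_act_le_op_norm[OF assms(1,2), of T ?v] by simp
qed

lemma op_norm_add_le:
  assumes "finite I" "finite J"
  shows "op_norm I J (\<lambda>i j. T i j + T' i j) \<le> op_norm I J T + op_norm I J T'"
proof (rule op_norm_le)
  fix v
  have "act J (\<lambda>i j. T i j + T' i j) v = (\<lambda>i. act J T v i + act J T' v i)"
    by (simp add: act_def algebra_simps sum.distrib)
  then have "l2 (act J (\<lambda>i j. T i j + T' i j) v) I \<le> l2 (act J T v) I + l2 (act J T' v) I"
    using l2_add_le by metis
  also have "\<dots> \<le> (op_norm I J T + op_norm I J T') * l2 v J"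
    using l2_act_le_op_norm[OF assms, of T v] l2_act_le_op_norm[OF assms, of T' v] by (simp add: algebra_simps)
  finally show "l2 (act J (\<lambda>i j. T i j + T' i j) v) I \<le> (op_norm I J T + op_norm I J T') * l2 v J" .
qed (simp add: assms op_norm_nonneg)

text \<open>The inequality \<open>le\<close> holds for all scalars; applied to
  \<open>inverse c\<close> and the scaled matrix it gives the converse.\<close>

lemma op_norm_scale:
  assumes "finite I" "finite J"
  shows "op_norm I J (\<lambda>i j. c * T i j) = cmod c * op_norm I J T"
proof -
  have le: "op_norm I J (\<lambda>i j. c * T i j) \<le> cmod c * op_norm I J T" for c T
  proof (rule op_norm_le)
    fix v
    have "act J (\<lambda>i j. c * T i j) v = (\<lambda>i. c * act J T v i)"
      by (simp add: act_def sum_distrib_left mult_ac)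
    then have "l2 (act J (\<lambda>i j. c * T i j) v) I = cmod c * l2 (act J T v) I"
      by (simp add: l2_scale)
    also have "\<dots> \<le> cmod c * (op_norm I J T * l2 v J)"
      by (intro mult_left_mono l2_act_le_op_norm assms) auto
    finally show "l2 (act J (\<lambda>i j. c * T i j) v) I \<le> cmod c * op_norm I J T * l2 v J"
      by simp
  qed (simp add: assms op_norm_nonneg)
  show ?thesis
  proof (cases "c = 0")
    case True
    then show ?thesis using le[of c T] op_norm_nonneg[OF assms, of "\<lambda>i j. c * T i j"] by simp
  next
    case False
    have "op_norm I J T \<le> cmod (inverse c) * op_norm I J (\<lambda>i j. c * T i j)"
      using le[of "inverse c" "\<lambda>i j. c * T i j"] False by (simp add: mult.assoc[symmetric])
    then have "cmod c * op_norm I J T \<le> cmod c * (cmod (inverse c) * op_norm I J (\<lambda>i j. c * T i j))"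
      by (intro mult_left_mono) auto
    then have "cmod c * op_norm I J T \<le> op_norm I J (\<lambda>i j. c * T i j)"
      using False by (simp add: norm_inverse mult.assoc[symmetric])
    then show ?thesis using le[of c T] by simp
  qed
qed

lemma l2_Times: "(l2 v (I \<times> S))\<^sup>2 = (\<Sum>s\<in>S. (l2 (\<lambda>i. v (i, s)) I)\<^sup>2)"
proof -
  have "(l2 v (I \<times> S))\<^sup>2 = (\<Sum>z\<in>I\<times>S. (cmod (v z))\<^sup>2)"
    by (simp add: L2_set_def sum_nonneg)
  also have "\<dots> = (\<Sum>s\<in>S. \<Sum>i\<in>I. (cmod (v (i, s)))\<^sup>2)"
    by (subst sum.swap) (simp add: sum.cartesian_product case_prod_beta)
  finally show ?thesis by (simp add: L2_set_def sum_nonneg)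
qed

text \<open>The operator is \<open>a \<otimes> id\<close>: it acts as \<open>a\<close> on each slice
  with fixed second index, and squared norms add over the slices.\<close>

lemma l2_amplification_le:
  assumes "finite I" "finite J" "finite S"
  shows "l2 (\<lambda>z. \<Sum>j\<in>J. a (fst z) j * u (j, snd z)) (I \<times> S) \<le> op_norm I J a * l2 u (J \<times> S)"
proof -
  let ?w = "\<lambda>z. \<Sum>j\<in>J. a (fst z) j * u (j, snd z)"
  have "(l2 ?w (I \<times> S))\<^sup>2 = (\<Sum>s\<in>S. (l2 (act J a (\<lambda>j. u (j, s))) I)\<^sup>2)"
    unfolding l2_Times by (simp add: act_def)
  also have "\<dots> \<le> (\<Sum>s\<in>S. (op_norm I J a * l2 (\<lambda>j. u (j, s)) J)\<^sup>2)"
    by (intro sum_mono power_mono l2_act_le_op_norm assms) auto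
  also have "\<dots> = (op_norm I J a * l2 u (J \<times> S))\<^sup>2"
    by (simp add: l2_Times power_mult_distrib sum_distrib_left)
  finally show ?thesis
    by (rule power2_le_imp_le) (simp add: op_norm_nonneg assms)
qed

section \<open>Ruan's axioms\<close>

text \<open>Definiteness is left out because a seminorm that looks at one block of a sequence has a
  large kernel; the remaining axioms pass to suprema and limits.\<close>

definition ruan_seminorm :: "vec set \<Rightarrow> (nat \<Rightarrow> vec mat \<Rightarrow> real) \<Rightarrow> bool" where
  "ruan_seminorm E N \<longleftrightarrow>
     (\<forall>n\<ge>1. \<forall>x\<in>matset E n n. 0 \<le> N n x) \<and>
     (\<forall>n\<ge>1. \<forall>x\<in>matset E n n. \<forall>y\<in>matset E n n. N n (madd x y) \<le> N n x + N n y) \<and>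
     (\<forall>n\<ge>1. \<forall>c. \<forall>x\<in>matset E n n. N n (msmul c x) = cmod c * N n x) \<and>
     (\<forall>m\<ge>1. \<forall>n\<ge>1. \<forall>a\<in>cmatset m n. \<forall>x\<in>matset E n n. \<forall>b\<in>cmatset n m.
        N m (triple_prod n a x b) \<le> cmat_norm m n a * N n x * cmat_norm n m b) \<and>
     (\<forall>m\<ge>1. \<forall>n\<ge>1. \<forall>x\<in>matset E m m. \<forall>y\<in>matset E n n.
        N (m + n) (dsum m x y) = max (N m x) (N n y))"

lemma ruan_seminormI:
  assumes "\<And>n x. n \<ge> 1 \<Longrightarrow> x \<in> matset E n n \<Longrightarrow> 0 \<le> N n x"
    and "\<And>n x y. n \<ge> 1 \<Longrightarrow> x \<in> matset E n n \<Longrightarrow> y \<in> matset E n n \<Longrightarrow> N n (madd x y) \<le> N n x + N n y"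
    and "\<And>n c x. n \<ge> 1 \<Longrightarrow> x \<in> matset E n n \<Longrightarrow> N n (msmul c x) = cmod c * N n x"
    and "\<And>m n a x b. m \<ge> 1 \<Longrightarrow> n \<ge> 1 \<Longrightarrow> a \<in> cmatset m n \<Longrightarrow> x \<in> matset E n n \<Longrightarrow> b \<in> cmatset n m \<Longrightarrow>
        N m (triple_prod n a x b) \<le> cmat_norm m n a * N n x * cmat_norm n m b"
    and "\<And>m n x y. m \<ge> 1 \<Longrightarrow> n \<ge> 1 \<Longrightarrow> x \<in> matset E m m \<Longrightarrow> y \<in> matset E n n \<Longrightarrow>
        N (m + n) (dsum m x y) = max (N m x) (N n y)"
  shows "ruan_seminorm E N"
  unfolding ruan_seminorm_def using assms by blast

lemma ruan_seminormD:
  assumes "ruan_seminorm E N"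
  shows "\<And>n x. n \<ge> 1 \<Longrightarrow> x \<in> matset E n n \<Longrightarrow> 0 \<le> N n x"
    and "\<And>n x y. n \<ge> 1 \<Longrightarrow> x \<in> matset E n n \<Longrightarrow> y \<in> matset E n n \<Longrightarrow> N n (madd x y) \<le> N n x + N n y"
    and "\<And>n c x. n \<ge> 1 \<Longrightarrow> x \<in> matset E n n \<Longrightarrow> N n (msmul c x) = cmod c * N n x"
    and "\<And>m n a x b. m \<ge> 1 \<Longrightarrow> n \<ge> 1 \<Longrightarrow> a \<in> cmatset m n \<Longrightarrow> x \<in> matset E n n \<Longrightarrow> b \<in> cmatset n m \<Longrightarrow>
        N m (triple_prod n a x b) \<le> cmat_norm m n a * N n x * cmat_norm n m b"
    and "\<And>m n x y. m \<ge> 1 \<Longrightarrow> n \<ge> 1 \<Longrightarrow> x \<in> matset E m m \<Longrightarrow> y \<in> matset E n n \<Longrightarrow>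
        N (m + n) (dsum m x y) = max (N m x) (N n y)"
  using assms unfolding ruan_seminorm_def by blast+

lemma csubsp_vsum:
  assumes "csubsp E" "finite I" "\<And>i. i \<in> I \<Longrightarrow> f i \<in> E"
  shows "vsum f I \<in> E"
  using assms(2,3)
proof (induction I rule: finite_induct)
  case empty
  then show ?case using assms(1) by (simp add: vsum_def csubsp_def vzero_def)
next
  case (insert i I)
  have "vsum f (insert i I) = vadd (f i) (vsum f I)"
    using insert by (simp add: vsum_def vadd_def)
  then show ?case using insert assms(1) by (simp add: csubsp_def)
qed

lemma matset_closed:
  assumes "csubsp E"
  shows "\<And>x y. x \<in> matset E n n \<Longrightarrow> y \<in> matset E n n \<Longrightarrow> madd x y \<in> matset E n n"
    and "\<And>c x. x \<in> matset E n n \<Longrightarrow> msmul c x \<in> matset E n n"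
    and "\<And>a x b. a \<in> cmatset m n \<Longrightarrow> x \<in> matset E n n \<Longrightarrow> b \<in> cmatset n m \<Longrightarrow>
      triple_prod n a x b \<in> matset E m m"
    and "\<And>x y. x \<in> matset E m m \<Longrightarrow> y \<in> matset E n n \<Longrightarrow> dsum m x y \<in> matset E (m + n) (m + n)"
proof -
  fix x y
  assume "x \<in> matset E n n" "y \<in> matset E n n"
  then show "madd x y \<in> matset E n n"
    using assms by (auto simp: matset_def madd_def csubsp_def) (auto simp: vadd_def vzero_def)
next
  fix x c
  assume "x \<in> matset E n n"
  then show "msmul c x \<in> matset E n n"
    using assms by (auto simp: matset_def msmul_def csubsp_def) (auto simp: vsmul_def vzero_def)
next
  fix x a b
  assume x: "a \<in> cmatset m n" "x \<in> matset E n n" "b \<in> cmatset n m"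
  have "triple_prod n a x b i j \<in> E" for i j
    unfolding triple_prod_def
    by (rule csubsp_vsum[OF assms]) (use x assms in \<open>auto simp: matset_def csubsp_def\<close>)
  moreover have "triple_prod n a x b i j = vzero" if "\<not> (i < m \<and> j < m)" for i j
    using x that by (auto simp: triple_prod_def cmatset_def vsum_def vsmul_def vzero_def fun_eq_iff intro!: sum.neutral)
  ultimately show "triple_prod n a x b \<in> matset E m m"
    by (auto simp: matset_def)
next
  fix x y
  assume xy: "x \<in> matset E m m" "y \<in> matset E n n"
  have "y (i - m) (j - m) \<in> E" if "m \<le> i" "m \<le> j" "i < m + n" "j < m + n" for i j
  proof -
    have "i - m < n \<and> j - m < n" using that by auto
    then show ?thesis using xy(2) unfolding matset_def by blast
  qed
  moreover have "y (i - m) (j - m) = vzero" if "m \<le> i" "m \<le> j" "\<not> (i < m + n \<and> j < m + n)" for i j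
  proof -
    have "\<not> (i - m < n \<and> j - m < n)" using that by auto
    then show ?thesis using xy(2) unfolding matset_def by blast
  qed
  ultimately show "dsum m x y \<in> matset E (m + n) (m + n)"
    using xy(1) assms by (auto simp: matset_def dsum_def csubsp_def)
qed

text \<open>Scaling by \<open>cmod c\<close> and taking \<open>max\<close> commute with suprema,
  which gives the two equalities among the axioms; the inequalities follow termwise.
  \<open>bdd\<close> makes every \<open>SUP\<close> an upper bound.\<close>

lemma ruan_seminorm_SUP:
  assumes "csubsp E" "A \<noteq> {}" "\<And>\<alpha>. \<alpha> \<in> A \<Longrightarrow> ruan_seminorm E (p \<alpha>)"
    and bdd: "\<And>n x. n \<ge> 1 \<Longrightarrow> x \<in> matset E n n \<Longrightarrow> bdd_above ((\<lambda>\<alpha>. p \<alpha> n x) ` A)"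
  shows "ruan_seminorm E (\<lambda>n x. SUP \<alpha>\<in>A. p \<alpha> n x)"
proof -
  have up: "p \<alpha> n x \<le> (SUP \<alpha>\<in>A. p \<alpha> n x)" if "\<alpha> \<in> A" "n \<ge> 1" "x \<in> matset E n n" for \<alpha> n x
    using that bdd by (intro cSUP_upper)
  note D = ruan_seminormD[OF assms(3)]
  obtain \<alpha>0 where \<alpha>0: "\<alpha>0 \<in> A" using assms(2) by blast
  have nn: "0 \<le> cmat_norm m n a" for m n a
    by (simp add: cmat_norm_eq_op_norm op_norm_nonneg)
  show ?thesis
  proof (rule ruan_seminormI)
    fix n :: nat and x assume "1 \<le> n" "x \<in> matset E n n"
    then show "0 \<le> (SUP \<alpha>\<in>A. p \<alpha> n x)" using up[OF \<alpha>0] D(1)[OF \<alpha>0] order_trans by blast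
  next
    fix n :: nat and x y assume h: "1 \<le> n" "x \<in> matset E n n" "y \<in> matset E n n"
    show "(SUP \<alpha>\<in>A. p \<alpha> n (madd x y)) \<le> (SUP \<alpha>\<in>A. p \<alpha> n x) + (SUP \<alpha>\<in>A. p \<alpha> n y)"
    proof (rule cSUP_least[OF assms(2)])
      fix \<alpha> assume "\<alpha> \<in> A"
      then show "p \<alpha> n (madd x y) \<le> (SUP \<alpha>\<in>A. p \<alpha> n x) + (SUP \<alpha>\<in>A. p \<alpha> n y)"
        using D(2)[of \<alpha> n x y] up[of \<alpha> n x] up[of \<alpha> n y] h by simp
    qed
  next
    fix n :: nat and c x assume h: "1 \<le> n" "x \<in> matset E n n"
    have "(SUP \<alpha>\<in>A. p \<alpha> n (msmul c x)) = (SUP \<alpha>\<in>A. cmod c * p \<alpha> n x)"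
      using D(3) h by (intro SUP_cong) auto
    also have "\<dots> = cmod c * (SUP \<alpha>\<in>A. p \<alpha> n x)"
    proof (rule antisym)
      show "(SUP \<alpha>\<in>A. cmod c * p \<alpha> n x) \<le> cmod c * (SUP \<alpha>\<in>A. p \<alpha> n x)"
        using up h by (intro cSUP_least assms(2) mult_left_mono) auto
      have bc: "bdd_above ((\<lambda>\<alpha>. cmod c * p \<alpha> n x) ` A)"
        using up h by (intro bdd_aboveI2[where M = "cmod c * (SUP \<alpha>\<in>A. p \<alpha> n x)"] mult_left_mono) auto
      show "cmod c * (SUP \<alpha>\<in>A. p \<alpha> n x) \<le> (SUP \<alpha>\<in>A. cmod c * p \<alpha> n x)"
      proof (cases "c = 0")
        case True
        then show ?thesis using assms(2) by simp
      next
        case False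
        have "(SUP \<alpha>\<in>A. p \<alpha> n x) \<le> (SUP \<alpha>\<in>A. cmod c * p \<alpha> n x) / cmod c"
        proof (rule cSUP_least[OF assms(2)])
          fix \<alpha> assume "\<alpha> \<in> A"
          from cSUP_upper[OF this bc] show "p \<alpha> n x \<le> (SUP \<alpha>\<in>A. cmod c * p \<alpha> n x) / cmod c"
            using False by (simp add: pos_le_divide_eq mult.commute)
        qed
        then show ?thesis using False by (simp add: pos_le_divide_eq mult.commute)
      qed
    qed
    finally show "(SUP \<alpha>\<in>A. p \<alpha> n (msmul c x)) = cmod c * (SUP \<alpha>\<in>A. p \<alpha> n x)" .
  next
    fix m n :: nat and a x b
    assume h: "1 \<le> m" "1 \<le> n" "a \<in> cmatset m n" "x \<in> matset E n n" "b \<in> cmatset n m"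
    show "(SUP \<alpha>\<in>A. p \<alpha> m (triple_prod n a x b)) \<le> cmat_norm m n a * (SUP \<alpha>\<in>A. p \<alpha> n x) * cmat_norm n m b"
    proof (rule cSUP_least[OF assms(2)])
      fix \<alpha> assume "\<alpha> \<in> A"
      then have "p \<alpha> m (triple_prod n a x b) \<le> cmat_norm m n a * p \<alpha> n x * cmat_norm n m b"
        using D(4) h by blast
      also have "\<dots> \<le> cmat_norm m n a * (SUP \<alpha>\<in>A. p \<alpha> n x) * cmat_norm n m b"
        using up \<open>\<alpha> \<in> A\<close> h by (intro mult_right_mono mult_left_mono nn) auto
      finally show "p \<alpha> m (triple_prod n a x b) \<le> cmat_norm m n a * (SUP \<alpha>\<in>A. p \<alpha> n x) * cmat_norm n m b" .
    qed
  next
    fix m n :: nat and x y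
    assume h: "1 \<le> m" "1 \<le> n" "x \<in> matset E m m" "y \<in> matset E n n"
    have "(SUP \<alpha>\<in>A. p \<alpha> (m + n) (dsum m x y)) = (SUP \<alpha>\<in>A. max (p \<alpha> m x) (p \<alpha> n y))"
      using D(5) h by (intro SUP_cong) auto
    also have "\<dots> = max (SUP \<alpha>\<in>A. p \<alpha> m x) (SUP \<alpha>\<in>A. p \<alpha> n y)"
    proof (rule antisym)
      show "(SUP \<alpha>\<in>A. max (p \<alpha> m x) (p \<alpha> n y)) \<le> max (SUP \<alpha>\<in>A. p \<alpha> m x) (SUP \<alpha>\<in>A. p \<alpha> n y)"
        using up h by (intro cSUP_least assms(2) max.mono) auto
      have bc: "bdd_above ((\<lambda>\<alpha>. max (p \<alpha> m x) (p \<alpha> n y)) ` A)"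
        using up h
        by (intro bdd_aboveI2[where M = "max (SUP \<alpha>\<in>A. p \<alpha> m x) (SUP \<alpha>\<in>A. p \<alpha> n y)"] max.mono) auto
      show "max (SUP \<alpha>\<in>A. p \<alpha> m x) (SUP \<alpha>\<in>A. p \<alpha> n y) \<le> (SUP \<alpha>\<in>A. max (p \<alpha> m x) (p \<alpha> n y))"
        by (intro max.boundedI cSUP_mono[OF assms(2) bc])
           (auto simp: le_max_iff_disj)
    qed
    finally show "(SUP \<alpha>\<in>A. p \<alpha> (m + n) (dsum m x y)) = max (SUP \<alpha>\<in>A. p \<alpha> m x) (SUP \<alpha>\<in>A. p \<alpha> n y)" .
  qed
qed

text \<open>All axioms are closed conditions. This serves for \<open>limit_norm\<close>, which is a
  decreasing limit of suprema rather than a supremum.\<close>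

lemma ruan_seminorm_lim:
  assumes "csubsp E" "\<And>K :: nat. ruan_seminorm E (P K)"
    and lim: "\<And>n x. n \<ge> 1 \<Longrightarrow> x \<in> matset E n n \<Longrightarrow> (\<lambda>K. P K n x) \<longlonglongrightarrow> N n x"
  shows "ruan_seminorm E N"
proof -
  note D = ruan_seminormD[OF assms(2)]
  note cl = matset_closed[OF assms(1)]
  show ?thesis
  proof (rule ruan_seminormI)
    fix n :: nat and x assume "1 \<le> n" "x \<in> matset E n n"
    then show "0 \<le> N n x" using D(1) by (intro LIMSEQ_le_const[OF lim]) auto
  next
    fix n :: nat and x y assume "1 \<le> n" "x \<in> matset E n n" "y \<in> matset E n n"
    then show "N n (madd x y) \<le> N n x + N n y"
      using D(2) cl(1) by (intro LIMSEQ_le[OF lim tendsto_add[OF lim lim]]) auto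
  next
    fix n :: nat and c x assume h: "1 \<le> n" "x \<in> matset E n n"
    have "(\<lambda>K. P K n (msmul c x)) \<longlonglongrightarrow> cmod c * N n x"
      using D(3) h tendsto_mult_left[OF lim[OF h]] by simp
    then show "N n (msmul c x) = cmod c * N n x"
      using lim[OF h(1) cl(2)[OF h(2)]] LIMSEQ_unique by blast
  next
    fix m n :: nat and a x b
    assume h: "1 \<le> m" "1 \<le> n" "a \<in> cmatset m n" "x \<in> matset E n n" "b \<in> cmatset n m"
    show "N m (triple_prod n a x b) \<le> cmat_norm m n a * N n x * cmat_norm n m b"
      by (rule LIMSEQ_le[OF lim[OF h(1) cl(3)[OF h(3-5)]]
            tendsto_mult[OF tendsto_mult[OF tendsto_const lim[OF h(2,4)]] tendsto_const]])
         (use D(4) h in auto)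
  next
    fix m n :: nat and x y
    assume h: "1 \<le> m" "1 \<le> n" "x \<in> matset E m m" "y \<in> matset E n n"
    have "(\<lambda>K. P K (m + n) (dsum m x y)) \<longlonglongrightarrow> max (N m x) (N n y)"
      using D(5)[OF h] tendsto_max[OF lim[OF h(1,3)] lim[OF h(2,4)]] by simp
    then show "N (m + n) (dsum m x y) = max (N m x) (N n y)"
      using lim[OF _ cl(4)[OF h(3,4)]] h(1) LIMSEQ_unique by auto
  qed
qed

lemma ruan_seminorm_subset:
  assumes "ruan_seminorm E N" "F \<subseteq> E"
  shows "ruan_seminorm F N"
proof -
  have "x \<in> matset E n n" if "x \<in> matset F n n" for n x
    using assms(2) that by (auto simp: matset_def)
  then show ?thesis
    using assms(1) unfolding ruan_seminorm_def by simp
qed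

text \<open>Definiteness is what \<open>ruan_seminorm\<close> lacks; \<open>entry\<close> supplies
  it, as a matrix of norm \<open>0\<close> then has all coordinates \<open>0\<close>.\<close>

lemma operator_spaceI:
  assumes "csubsp E" "ruan_seminorm E N"
    and entry: "\<And>n x i j k. n \<ge> 1 \<Longrightarrow> x \<in> matset E n n \<Longrightarrow> i < n \<Longrightarrow> j < n \<Longrightarrow> cmod (x i j k) \<le> N n x"
  shows "operator_space E N"
proof -
  note D = ruan_seminormD[OF assms(2)]
  have "N n x = 0 \<longleftrightarrow> x = (\<lambda>i j. vzero)" if h: "n \<ge> 1" "x \<in> matset E n n" for n x
  proof
    assume "N n x = 0"
    then have "x i j = vzero" if "i < n" "j < n" for i j
      using entry[OF h that] by (simp add: vzero_def fun_eq_iff)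
    moreover have "x i j = vzero" if "\<not> (i < n \<and> j < n)" for i j
      using h that by (auto simp: matset_def)
    ultimately show "x = (\<lambda>i j. vzero)" by (intro ext) metis
  next
    assume "x = (\<lambda>i j. vzero)"
    then have "x = msmul 0 x" by (simp add: msmul_def vsmul_def vzero_def)
    then show "N n x = 0" using D(3)[OF h, of 0] by simp
  qed
  then show ?thesis
    unfolding operator_space_def using assms(1) D by blast
qed

section \<open>Seminorms induced by matrix representations\<close>

text \<open>For linear \<open>r\<close> this is the operator norm of matrices over the operators on
  functions on \<open>S\<close>, pulled back along \<open>r\<close>.\<close>

definition rep_norm :: "(vec \<Rightarrow> 's \<Rightarrow> 's \<Rightarrow> complex) \<Rightarrow> 's set \<Rightarrow> nat \<Rightarrow> vec mat \<Rightarrow> real" where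
  "rep_norm r S n x = op_norm ({..<n} \<times> S) ({..<n} \<times> S) (\<lambda>z w. r (x (fst z) (fst w)) (snd z) (snd w))"

text \<open>As for any space of operators: \<open>triple_prod\<close> becomes a product with
  \<open>a \<otimes> id\<close> and \<open>b \<otimes> id\<close> on the two sides, and
  \<open>dsum\<close> becomes a block diagonal operator, whose norm is found by splitting vectors
  orthogonally.\<close>

lemma ruan_seminorm_rep_norm:
  fixes r :: "vec \<Rightarrow> 's \<Rightarrow> 's \<Rightarrow> complex"
  assumes fin: "finite S"
    and add: "\<And>u v s t. r (vadd u v) s t = r u s t + r v s t"
    and smul: "\<And>c v s t. r (vsmul c v) s t = c * r v s t"
  shows "ruan_seminorm E (rep_norm r S)"
proof (rule ruan_seminormI)
  fix n x show "0 \<le> rep_norm r S n x" using fin by (simp add: rep_norm_def op_norm_nonneg)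
next
  fix n x y
  show "rep_norm r S n (madd x y) \<le> rep_norm r S n x + rep_norm r S n y"
    unfolding rep_norm_def madd_def add by (rule op_norm_add_le) (simp_all add: fin)
next
  fix n c x
  show "rep_norm r S n (msmul c x) = cmod c * rep_norm r S n x"
    unfolding rep_norm_def msmul_def smul by (rule op_norm_scale) (simp_all add: fin)
next
  fix m n :: nat and a b :: "complex mat" and x :: "vec mat"
  have zero: "r (\<lambda>k. 0) s t = 0" for s t
    using smul[of 0 "\<lambda>k. 0" s t] by (simp add: vsmul_def)
  have rsum: "r (vsum f I) s t = (\<Sum>i\<in>I. r (f i) s t)" if "finite I" for f s t and I :: "(nat \<times> nat) set"
    using that
  proof (induction I rule: finite_induct)
    case empty
    then show ?case by (simp add: vsum_def zero)
  next
    case (insert i I)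
    have "vsum f (insert i I) = vadd (f i) (vsum f I)"
      using insert by (simp add: vsum_def vadd_def)
    then show ?case using insert by (simp add: add)
  qed
  let ?T = "\<lambda>z w. r (x (fst z) (fst w)) (snd z) (snd w)"
  let ?T' = "\<lambda>z w. r (triple_prod n a x b (fst z) (fst w)) (snd z) (snd w)"
  show "rep_norm r S m (triple_prod n a x b) \<le> cmat_norm m n a * rep_norm r S n x * cmat_norm n m b"
    unfolding rep_norm_def cmat_norm_eq_op_norm
  proof (rule op_norm_le)
    show "0 \<le> op_norm {..<m} {..<n} a * op_norm ({..<n} \<times> S) ({..<n} \<times> S) ?T * op_norm {..<n} {..<m} b"
      by (simp add: op_norm_nonneg fin)
    fix v :: "nat \<times> 's \<Rightarrow> complex"
    \<comment> \<open>\<open>u\<close> is \<open>b \<otimes> id\<close> applied to \<open>v\<close>;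
      the sums below factor the action of the triple product through it.\<close>
    define u where "u z = (\<Sum>l<m. b (fst z) l * v (l, snd z))" for z
    have "act ({..<m} \<times> S) ?T' v z = (\<Sum>j<n. a (fst z) j * act ({..<n} \<times> S) ?T u (j, snd z))" for z
    proof -
      have "act ({..<m} \<times> S) ?T' v z =
        (\<Sum>(l,t)\<in>{..<m}\<times>S. \<Sum>(j,k)\<in>{..<n}\<times>{..<n}. a (fst z) j * b k l * r (x j k) (snd z) t * v (l,t))"
        by (auto simp: act_def triple_prod_def rsum smul sum_distrib_right case_prod_beta intro!: sum.cong)
      also have "\<dots> = (\<Sum>(j,k)\<in>{..<n}\<times>{..<n}. \<Sum>(l,t)\<in>{..<m}\<times>S. a (fst z) j * b k l * r (x j k) (snd z) t * v (l,t))"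
        unfolding case_prod_beta by (rule sum.swap)
      also have "\<dots> = (\<Sum>j<n. \<Sum>k<n. \<Sum>t\<in>S. \<Sum>l<m. a (fst z) j * b k l * r (x j k) (snd z) t * v (l,t))"
        by (simp add: sum.cartesian_product[symmetric] sum.swap[of _ S])
      also have "\<dots> = (\<Sum>j<n. a (fst z) j * act ({..<n} \<times> S) ?T u (j, snd z))"
        by (simp add: act_def u_def sum_distrib_left sum.cartesian_product' mult_ac)
      finally show ?thesis .
    qed
    then have "l2 (act ({..<m} \<times> S) ?T' v) ({..<m} \<times> S) =
        l2 (\<lambda>z. \<Sum>j<n. a (fst z) j * act ({..<n} \<times> S) ?T u (j, snd z)) ({..<m} \<times> S)"
      by simp
    also have "\<dots> \<le> op_norm {..<m} {..<n} a * l2 (act ({..<n} \<times> S) ?T u) ({..<n} \<times> S)"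
      by (rule l2_amplification_le) (simp_all add: fin)
    also have "\<dots> \<le> op_norm {..<m} {..<n} a * (op_norm ({..<n} \<times> S) ({..<n} \<times> S) ?T * l2 u ({..<n} \<times> S))"
      by (intro mult_left_mono l2_act_le_op_norm op_norm_nonneg) (simp_all add: fin)
    also have "\<dots> \<le> op_norm {..<m} {..<n} a * (op_norm ({..<n} \<times> S) ({..<n} \<times> S) ?T *
        (op_norm {..<n} {..<m} b * l2 v ({..<m} \<times> S)))"
      unfolding u_def by (intro mult_left_mono l2_amplification_le op_norm_nonneg) (simp_all add: fin)
    finally show "l2 (act ({..<m} \<times> S) ?T' v) ({..<m} \<times> S)
        \<le> op_norm {..<m} {..<n} a * op_norm ({..<n} \<times> S) ({..<n} \<times> S) ?T * op_norm {..<n} {..<m} b * l2 v ({..<m} \<times> S)"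
      by (simp add: mult_ac)
  qed
next
  fix m n :: nat and x y
  have zero: "r vzero s t = 0" for s t
    using smul[of 0 vzero s t] by (simp add: vsmul_def vzero_def)
  let ?T = "\<lambda>x z w. r (x (fst z) (fst w)) (snd z) (snd w)"
  let ?I = "\<lambda>n. {..<n} \<times> S"
  let ?d = "dsum m x y"
  have split: "(\<Sum>z\<in>?I (m + n). f z) = (\<Sum>z\<in>?I m. f z) + (\<Sum>z\<in>?I n. f (fst z + m, snd z))"
    for f :: "nat \<times> 's \<Rightarrow> 'c :: comm_monoid_add"
  proof -
    have "(\<Sum>i<m+n. h i) = (\<Sum>i<m. h i) + (\<Sum>i<n. h (i + m))" for h :: "nat \<Rightarrow> 'c"
      by (induction n) (auto simp: add_ac)
    then show ?thesis by (simp add: sum.cartesian_product')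
  qed
  have l2split: "(l2 v (?I (m+n)))\<^sup>2 = (l2 v (?I m))\<^sup>2 + (l2 (\<lambda>z. v (fst z + m, snd z)) (?I n))\<^sup>2" for v
    by (simp add: L2_set_def sum_nonneg split)
  have act1: "act (?I (m+n)) (?T ?d) v z = act (?I m) (?T x) v z" if "z \<in> ?I m" for v z
  proof -
    have "(\<Sum>w\<in>?I n. ?T ?d z (fst w + m, snd w) * v (fst w + m, snd w)) = 0"
      using that by (intro sum.neutral) (auto simp: dsum_def zero)
    moreover have "(\<Sum>w\<in>?I m. ?T ?d z w * v w) = (\<Sum>w\<in>?I m. ?T x z w * v w)"
      using that by (intro sum.cong) (auto simp: dsum_def)
    ultimately show ?thesis unfolding act_def split by simp
  qed
  have act2: "act (?I (m+n)) (?T ?d) v (i + m, s) = act (?I n) (?T y) (\<lambda>z. v (fst z + m, snd z)) (i, s)" for v i s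
  proof -
    have "(\<Sum>w\<in>?I m. ?T ?d (i + m, s) w * v w) = 0"
      by (intro sum.neutral) (auto simp: dsum_def zero)
    moreover have "(\<Sum>w\<in>?I n. ?T ?d (i + m, s) (fst w + m, snd w) * v (fst w + m, snd w)) =
        (\<Sum>w\<in>?I n. ?T y (i, s) w * v (fst w + m, snd w))"
      by (intro sum.cong) (auto simp: dsum_def)
    ultimately show ?thesis unfolding act_def split by simp
  qed
  \<comment> \<open>The two diagonal blocks act on orthogonal parts of \<open>v\<close> and have
    orthogonal images, so squared norms add.\<close>
  have key: "(l2 (act (?I (m+n)) (?T ?d) v) (?I (m+n)))\<^sup>2 =
     (l2 (act (?I m) (?T x) v) (?I m))\<^sup>2 + (l2 (act (?I n) (?T y) (\<lambda>z. v (fst z + m, snd z))) (?I n))\<^sup>2" for v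
    unfolding l2split act2 by (simp add: act1 cong: L2_set_cong)
  let ?M = "max (rep_norm r S m x) (rep_norm r S n y)"
  have M: "0 \<le> ?M" by (simp add: rep_norm_def op_norm_nonneg fin le_max_iff_disj)
  have bx: "l2 (act (?I m) (?T x) v) (?I m) \<le> rep_norm r S m x * l2 v (?I m)" for v
    unfolding rep_norm_def by (rule l2_act_le_op_norm) (simp_all add: fin)
  have "by": "l2 (act (?I n) (?T y) v) (?I n) \<le> rep_norm r S n y * l2 v (?I n)" for v
    unfolding rep_norm_def by (rule l2_act_le_op_norm) (simp_all add: fin)
  have bd: "l2 (act (?I (m+n)) (?T ?d) v) (?I (m+n)) \<le> rep_norm r S (m+n) ?d * l2 v (?I (m+n))" for v
    unfolding rep_norm_def by (rule l2_act_le_op_norm) (simp_all add: fin)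
  show "rep_norm r S (m + n) ?d = ?M"
  proof (rule antisym)
    show "rep_norm r S (m + n) ?d \<le> ?M"
      unfolding rep_norm_def[of r S "m + n"]
    proof (rule op_norm_le[OF M])
      fix v :: "nat \<times> 's \<Rightarrow> complex"
      let ?v = "\<lambda>z. v (fst z + m, snd z)"
      have "l2 (act (?I m) (?T x) v) (?I m) \<le> ?M * l2 v (?I m)"
        using bx[of v] mult_right_mono[of "rep_norm r S m x" ?M "l2 v (?I m)"] by simp
      moreover have "l2 (act (?I n) (?T y) ?v) (?I n) \<le> ?M * l2 ?v (?I n)"
        using "by"[of ?v] mult_right_mono[of "rep_norm r S n y" ?M "l2 ?v (?I n)"] by simp
      ultimately have "(l2 (act (?I (m+n)) (?T ?d) v) (?I (m+n)))\<^sup>2 \<le> (?M * l2 v (?I m))\<^sup>2 + (?M * l2 ?v (?I n))\<^sup>2"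
        unfolding key by (intro add_mono power_mono) auto
      also have "\<dots> = (?M * l2 v (?I (m+n)))\<^sup>2"
        by (simp only: power_mult_distrib l2split distrib_left)
      finally show "l2 (act (?I (m+n)) (?T ?d) v) (?I (m+n)) \<le> ?M * l2 v (?I (m+n))"
        by (rule power2_le_imp_le) (use M in simp)
    qed
    have d0: "0 \<le> rep_norm r S (m+n) ?d" by (simp add: rep_norm_def op_norm_nonneg fin)
    \<comment> \<open>Extending a vector by \<open>0\<close> to the other block keeps its norm and
      the action of its own block, so neither block can exceed the direct sum.\<close>
    have "rep_norm r S m x \<le> rep_norm r S (m+n) ?d"
      unfolding rep_norm_def[of r S m]
    proof (rule op_norm_le[OF d0])
      fix v :: "nat \<times> 's \<Rightarrow> complex"
      let ?v = "\<lambda>z. if fst z < m then v z else 0"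
      have e: "l2 ?v (?I (m+n)) = l2 v (?I m)"
        by (simp add: L2_set_def split) (rule sum.cong, auto)
      have "act (?I m) (?T x) ?v = act (?I m) (?T x) v"
        by (auto simp: act_def intro!: sum.cong)
      then have "(l2 (act (?I m) (?T x) v) (?I m))\<^sup>2 \<le> (l2 (act (?I (m+n)) (?T ?d) ?v) (?I (m+n)))\<^sup>2"
        unfolding key by simp
      then have "l2 (act (?I m) (?T x) v) (?I m) \<le> l2 (act (?I (m+n)) (?T ?d) ?v) (?I (m+n))"
        by (rule power2_le_imp_le) simp
      also have "\<dots> \<le> rep_norm r S (m+n) ?d * l2 v (?I m)" using bd[of ?v] e by simp
      finally show "l2 (act (?I m) (?T x) v) (?I m) \<le> rep_norm r S (m+n) ?d * l2 v (?I m)" .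
    qed
    moreover have "rep_norm r S n y \<le> rep_norm r S (m+n) ?d"
      unfolding rep_norm_def[of r S n]
    proof (rule op_norm_le[OF d0])
      fix v :: "nat \<times> 's \<Rightarrow> complex"
      let ?v = "\<lambda>z. if m \<le> fst z then v (fst z - m, snd z) else 0"
      have e: "l2 ?v (?I (m+n)) = l2 v (?I n)"
      proof -
        have "(\<Sum>z\<in>?I m. (cmod (?v z))\<^sup>2) = 0" by (intro sum.neutral) auto
        then show ?thesis by (simp add: L2_set_def split)
      qed
      have "(\<lambda>z. ?v (fst z + m, snd z)) = v" by auto
      then have "(l2 (act (?I n) (?T y) v) (?I n))\<^sup>2 \<le> (l2 (act (?I (m+n)) (?T ?d) ?v) (?I (m+n)))\<^sup>2"
        unfolding key by simp
      then have "l2 (act (?I n) (?T y) v) (?I n) \<le> l2 (act (?I (m+n)) (?T ?d) ?v) (?I (m+n))"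
        by (rule power2_le_imp_le) simp
      also have "\<dots> \<le> rep_norm r S (m+n) ?d * l2 v (?I n)" using bd[of ?v] e by simp
      finally show "l2 (act (?I n) (?T y) v) (?I n) \<le> rep_norm r S (m+n) ?d * l2 v (?I n)" .
    qed
    ultimately show "?M \<le> rep_norm r S (m + n) ?d" by simp
  qed
qed

section \<open>The spectral gap\<close>

text \<open>A representative of \<open>t\<close> modulo the integers of least absolute value; it
  turns relations on the torus near \<open>0\<close> into relations between real numbers.\<close>

definition centered :: "real \<Rightarrow> real" where "centered t = t - of_int (round t)"

text \<open>Uniqueness of the nearest integer, hence the strict bound. Two centred numbers below
  \<open>1/4\<close> in modulus have a sum and a difference that this covers, so nothing wraps
  around.\<close>

lemma centered_eqI:
  assumes "t - u \<in> \<int>" "\<bar>u\<bar> < 1/2"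
  shows "centered t = u"
proof -
  from assms(1) obtain k :: int where k: "t - u = of_int k" by (auto elim: Ints_cases)
  then have "t - of_int k = u" by simp
  have "round t = k"
    using assms(2) \<open>t - of_int k = u\<close> by (intro round_unique') simp
  then show ?thesis using k by (simp add: centered_def)
qed

lemma abs_centered_le: "\<bar>centered t\<bar> \<le> 1/2"
  using of_int_round_abs_le[of t] by (simp add: centered_def abs_minus_commute)

lemma centered_diff_Ints: "t - centered t \<in> \<int>"
  by (simp add: centered_def)

text \<open>The squared distance of \<open>cis \<phi>\<close> from \<open>1\<close> is
  \<open>2 - 2 * cos \<phi>\<close>, and the cosine is at most \<open>0\<close> at angles whose
  modulus lies between \<open>pi / 2\<close> and \<open>pi\<close>.\<close>

lemma cmod_cis_minus_one_ge:
  assumes "1/4 \<le> \<bar>centered t\<bar>"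
  shows "2 \<le> (cmod (cis (2 * pi * t) - 1))\<^sup>2"
proof -
  have "cis (2 * pi * t) = cis (2 * pi * centered t)"
  proof -
    have "2 * pi * t = 2 * pi * centered t + 2 * pi * of_int (round t)"
      by (simp add: centered_def algebra_simps)
    then have "cis (2 * pi * t) = cis (2 * pi * centered t) * cis (2 * pi * of_int (round t))"
      by (simp only: cis_mult)
    moreover have "cis (2 * pi * of_int (round t)) = 1"
      by (rule cis_multiple_2pi) simp
    ultimately show ?thesis by simp
  qed
  then have "(cmod (cis (2 * pi * t) - 1))\<^sup>2 = (cos (2 * pi * centered t) - 1)\<^sup>2 + (sin (2 * pi * centered t))\<^sup>2"
    by (simp add: cmod_power2)
  also have "\<dots> = 2 - 2 * cos (2 * pi * centered t)"
    using sin_cos_squared_add[of "2 * pi * centered t"] by (simp add: power2_eq_square algebra_simps)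
  finally have eq: "(cmod (cis (2 * pi * t) - 1))\<^sup>2 = 2 - 2 * cos (2 * pi * \<bar>centered t\<bar>)"
    by (cases "0 \<le> centered t") auto
  have "0 \<le> sin (2 * pi * \<bar>centered t\<bar> - pi/2)"
    using assms abs_centered_le[of t] by (intro sin_ge_zero) (auto simp: field_simps)
  then have "cos (2 * pi * \<bar>centered t\<bar>) \<le> 0"
    by (simp add: sin_diff)
  then show ?thesis using eq by simp
qed

text \<open>The difference of the squared norms factors. This converts closeness of \<open>f\<close>
  and \<open>g\<close> in the \<open>l2\<close> norm into closeness of the masses that their squared
  moduli give to \<open>A\<close>.\<close>

lemma abs_sum_squares_diff_le:
  assumes "finite A"
  shows "\<bar>(\<Sum>z\<in>A. (cmod (f z))\<^sup>2) - (\<Sum>z\<in>A. (cmod (g z))\<^sup>2)\<bar>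
    \<le> l2 (\<lambda>z. f z - g z) A * (l2 f A + l2 g A)"
proof -
  have e: "(\<Sum>z\<in>A. (cmod (f z))\<^sup>2) = (l2 f A)\<^sup>2" for f
    by (simp add: L2_set_def sum_nonneg)
  have "l2 f A \<le> l2 (\<lambda>z. f z - g z) A + l2 g A"
    using l2_add_le[of "\<lambda>z. f z - g z" g A] by simp
  moreover have "l2 g A \<le> l2 (\<lambda>z. f z - g z) A + l2 f A"
    using l2_add_le[of "\<lambda>z. g z - f z" f A] by (simp add: norm_minus_commute)
  ultimately have "\<bar>l2 f A - l2 g A\<bar> \<le> l2 (\<lambda>z. f z - g z) A" by linarith
  then have "\<bar>l2 f A - l2 g A\<bar> * (l2 f A + l2 g A) \<le> l2 (\<lambda>z. f z - g z) A * (l2 f A + l2 g A)"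
    by (rule mult_right_mono) simp
  moreover have "(l2 f A)\<^sup>2 - (l2 g A)\<^sup>2 = (l2 f A - l2 g A) * (l2 f A + l2 g A)"
    by (simp add: power2_eq_square algebra_simps)
  moreover have "\<bar>(l2 f A - l2 g A) * (l2 f A + l2 g A)\<bar> = \<bar>l2 f A - l2 g A\<bar> * (l2 f A + l2 g A)"
    by (simp add: abs_mult)
  ultimately show ?thesis unfolding e by simp
qed

text \<open>Ping-pong: near \<open>0\<close>, the two shears map the open quadrants \<open>xy > 0\<close> into disjoint halves of
  themselves, and their inverses do the same for \<open>xy < 0\<close>; so the mass of an almost invariant
  vector would have to sit at \<open>0\<close>, which the last hypothesis excludes.\<close>

lemma no_almost_invariant_vector:
  fixes w1 w2 :: "'z \<Rightarrow> real" and S T :: "'z \<Rightarrow> 'z" and f :: "'z \<Rightarrow> complex"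
  assumes fin: "finite Z" and S: "bij_betw S Z Z" and T: "bij_betw T Z Z"
    and S1: "\<And>z. z \<in> Z \<Longrightarrow> w1 (S z) - (w1 z + w2 z) \<in> \<int>"
    and S2: "\<And>z. z \<in> Z \<Longrightarrow> w2 (S z) - w2 z \<in> \<int>"
    and T1: "\<And>z. z \<in> Z \<Longrightarrow> w1 (T z) - w1 z \<in> \<int>"
    and T2: "\<And>z. z \<in> Z \<Longrightarrow> w2 (T z) - (w1 z + w2 z) \<in> \<int>"
    and nz: "\<And>z. z \<in> Z \<Longrightarrow> \<not> (w1 z \<in> \<int> \<and> w2 z \<in> \<int>)"
    and k1: "l2 (\<lambda>z. cis (2 * pi * w1 z) * f z - f z) Z \<le> 1/25 * l2 f Z"
    and k2: "l2 (\<lambda>z. cis (2 * pi * w2 z) * f z - f z) Z \<le> 1/25 * l2 f Z"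
    and kS: "l2 (\<lambda>z. f (S z) - f z) Z \<le> 1/25 * l2 f Z"
    and kT: "l2 (\<lambda>z. f (T z) - f z) Z \<le> 1/25 * l2 f Z"
  shows "l2 f Z = 0"
proof -
  define u v where "u z = centered (w1 z)" and "v z = centered (w2 z)" for z
  define \<mu> where "\<mu> P = (\<Sum>z\<in>{z\<in>Z. P z}. (cmod (f z))\<^sup>2)" for P
  define M where "M = (l2 f Z)\<^sup>2"
  have M: "M = \<mu> (\<lambda>_. True)" by (simp add: M_def \<mu>_def L2_set_def sum_nonneg)
  have mono: "\<mu> P \<le> \<mu> Q" if "\<And>z. z \<in> Z \<Longrightarrow> P z \<Longrightarrow> Q z" for P Q
    unfolding \<mu>_def using fin that by (intro sum_mono2) auto
  have sub: "\<mu> P \<le> \<mu> Q + \<mu> R" if "\<And>z. z \<in> Z \<Longrightarrow> P z \<Longrightarrow> Q z \<or> R z" for P Q R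
  proof -
    have "\<mu> P \<le> (\<Sum>z\<in>{z\<in>Z. Q z} \<union> {z\<in>Z. R z}. (cmod (f z))\<^sup>2)"
      unfolding \<mu>_def using fin that by (intro sum_mono2) auto
    also have "\<dots> \<le> \<mu> Q + \<mu> R"
      unfolding \<mu>_def using fin by (subst sum_Un) (auto intro!: sum_nonneg)
    finally show ?thesis .
  qed
  have disj: "\<mu> Q + \<mu> R \<le> \<mu> P"
    if "\<And>z. z \<in> Z \<Longrightarrow> Q z \<or> R z \<Longrightarrow> P z" "\<And>z. z \<in> Z \<Longrightarrow> Q z \<Longrightarrow> R z \<Longrightarrow> False" for P Q R
  proof -
    have "\<mu> Q + \<mu> R = (\<Sum>z\<in>{z\<in>Z. Q z} \<union> {z\<in>Z. R z}. (cmod (f z))\<^sup>2)"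
      unfolding \<mu>_def using fin that(2) by (intro sum.union_disjoint[symmetric]) auto
    also have "\<dots> \<le> \<mu> P"
      unfolding \<mu>_def using fin that(1) by (intro sum_mono2) auto
    finally show ?thesis .
  qed
  \<comment> \<open>\<open>1/1250\<close> is half of \<open>(1/25)^2\<close>: on this set the phase
    moves \<open>f z\<close> by at least \<open>sqrt 2\<close> times its modulus.\<close>
  have far: "\<mu> (\<lambda>z. 1/4 \<le> \<bar>centered (w z)\<bar>) \<le> 1/1250 * M"
    if "l2 (\<lambda>z. cis (2 * pi * w z) * f z - f z) Z \<le> 1/25 * l2 f Z" for w :: "'z \<Rightarrow> real"
  proof -
    let ?A = "{z\<in>Z. 1/4 \<le> \<bar>centered (w z)\<bar>}"
    have "2 * \<mu> (\<lambda>z. 1/4 \<le> \<bar>centered (w z)\<bar>) = (\<Sum>z\<in>?A. 2 * (cmod (f z))\<^sup>2)"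
      by (simp add: \<mu>_def sum_distrib_left)
    also have "\<dots> \<le> (\<Sum>z\<in>?A. (cmod (cis (2 * pi * w z) * f z - f z))\<^sup>2)"
    proof (rule sum_mono)
      fix z assume "z \<in> ?A"
      then have "2 * (cmod (f z))\<^sup>2 \<le> (cmod (cis (2 * pi * w z) - 1))\<^sup>2 * (cmod (f z))\<^sup>2"
        by (intro mult_right_mono cmod_cis_minus_one_ge) auto
      also have "\<dots> = (cmod (cis (2 * pi * w z) * f z - f z))\<^sup>2"
        by (simp add: power_mult_distrib[symmetric] norm_mult[symmetric] algebra_simps)
      finally show "2 * (cmod (f z))\<^sup>2 \<le> (cmod (cis (2 * pi * w z) * f z - f z))\<^sup>2" .
    qed
    also have "\<dots> \<le> (\<Sum>z\<in>Z. (cmod (cis (2 * pi * w z) * f z - f z))\<^sup>2)"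
      using fin by (intro sum_mono2) auto
    also have "\<dots> = (l2 (\<lambda>z. cis (2 * pi * w z) * f z - f z) Z)\<^sup>2"
      by (simp add: L2_set_def sum_nonneg)
    also have "\<dots> \<le> (1/25 * l2 f Z)\<^sup>2"
      using that by (intro power_mono) auto
    also have "\<dots> = 1/625 * M" by (simp add: M_def power_mult_distrib power_divide)
    finally show ?thesis by simp
  qed
  \<comment> \<open>The factor \<open>2/25\<close> is \<open>1/25\<close> times two norms, those of
    \<open>f\<close> and of its translate, which on the whole of \<open>Z\<close> both equal
    \<open>l2 f Z\<close> because \<open>R\<close> permutes \<open>Z\<close>.\<close>
  have shift: "\<bar>\<mu> P - \<mu> Q\<bar> \<le> 2/25 * M"
    if R: "bij_betw R Z Z" and kR: "l2 (\<lambda>z. f (R z) - f z) Z \<le> 1/25 * l2 f Z"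
      and PQ: "\<And>z. z \<in> Z \<Longrightarrow> Q z \<longleftrightarrow> P (R z)" for P Q R
  proof -
    let ?A = "{z\<in>Z. Q z}"
    have mon: "l2 h ?A \<le> l2 h Z" for h :: "'z \<Rightarrow> complex"
      unfolding L2_set_def using fin by (intro real_sqrt_le_mono sum_mono2) auto
    have bij: "bij_betw R ?A {z\<in>Z. P z}"
      using R PQ unfolding bij_betw_def inj_on_def by (auto 0 4 simp: image_iff set_eq_iff)
    then have "\<mu> P = (\<Sum>z\<in>?A. (cmod (f (R z)))\<^sup>2)"
      unfolding \<mu>_def by (rule sum.reindex_bij_betw[symmetric])
    then have "\<bar>\<mu> P - \<mu> Q\<bar> \<le> l2 (\<lambda>z. f (R z) - f z) ?A * (l2 (\<lambda>z. f (R z)) ?A + l2 f ?A)"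
      unfolding \<mu>_def[of Q] using abs_sum_squares_diff_le[of ?A "\<lambda>z. f (R z)" f] fin by simp
    also have "\<dots> \<le> l2 (\<lambda>z. f (R z) - f z) Z * (l2 (\<lambda>z. f (R z)) Z + l2 f Z)"
      by (intro mult_mono add_mono mon) auto
    also have "l2 (\<lambda>z. f (R z)) Z = l2 f Z"
      unfolding L2_set_def using sum.reindex_bij_betw[OF R, of "\<lambda>z. (cmod (f z))\<^sup>2"] by simp
    also have "l2 (\<lambda>z. f (R z) - f z) Z * (l2 f Z + l2 f Z) \<le> 1/25 * l2 f Z * (l2 f Z + l2 f Z)"
      by (intro mult_right_mono kR) auto
    finally show ?thesis by (simp add: M_def power2_eq_square algebra_simps)
  qed
  \<comment> \<open>Inside this box the shears act on the centred coordinates as on the plane, since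
    sums stay below \<open>1/2\<close> in modulus.\<close>
  define B where "B z \<longleftrightarrow> \<bar>u z\<bar> < 1/4 \<and> \<bar>v z\<bar> < 1/4" for z
  have notB: "\<mu> (\<lambda>z. \<not> B z) \<le> 1/625 * M"
    using sub[of "\<lambda>z. \<not> B z" "\<lambda>z. 1/4 \<le> \<bar>u z\<bar>" "\<lambda>z. 1/4 \<le> \<bar>v z\<bar>"] far[OF k1] far[OF k2]
    by (fastforce simp: B_def u_def v_def)
  have Sz: "u (S z) = u z + v z" "v (S z) = v z" if "z \<in> Z" "B z" for z
  proof -
    have "w1 (S z) - (u z + v z) = (w1 (S z) - (w1 z + w2 z)) + (w1 z - u z) + (w2 z - v z)" by simp
    then have "w1 (S z) - (u z + v z) \<in> \<int>"
      using S1[OF that(1)] centered_diff_Ints unfolding u_def v_def by (metis Ints_add)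
    then show "u (S z) = u z + v z" unfolding u_def[of "S z"] using that(2)
      unfolding B_def by - (rule centered_eqI, assumption, elim conjE, linarith)
    have "w2 (S z) - v z = (w2 (S z) - w2 z) + (w2 z - v z)" by simp
    then have "w2 (S z) - v z \<in> \<int>"
      using S2[OF that(1)] centered_diff_Ints unfolding v_def by (metis Ints_add)
    then show "v (S z) = v z" unfolding v_def[of "S z"] using that(2)
      unfolding B_def by - (rule centered_eqI, assumption, elim conjE, linarith)
  qed
  have Tz: "v (T z) = u z + v z" "u (T z) = u z" if "z \<in> Z" "B z" for z
  proof -
    have "w2 (T z) - (u z + v z) = (w2 (T z) - (w1 z + w2 z)) + (w1 z - u z) + (w2 z - v z)" by simp
    then have "w2 (T z) - (u z + v z) \<in> \<int>"
      using T2[OF that(1)] centered_diff_Ints unfolding u_def v_def by (metis Ints_add)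
    then show "v (T z) = u z + v z" unfolding v_def[of "T z"] using that(2)
      unfolding B_def by - (rule centered_eqI, assumption, elim conjE, linarith)
    have "w1 (T z) - u z = (w1 (T z) - w1 z) + (w1 z - u z)" by simp
    then have "w1 (T z) - u z \<in> \<int>"
      using T1[OF that(1)] centered_diff_Ints unfolding u_def by (metis Ints_add)
    then show "u (T z) = u z" unfolding u_def[of "T z"] using that(2)
      unfolding B_def by - (rule centered_eqI, assumption, elim conjE, linarith)
  qed
  \<comment> \<open>For the inverse shears the box condition is put on the image point, from which
    the original point is recovered by subtraction.\<close>
  have Sz': "u z = u (S z) - v (S z)" "v z = v (S z)" if "z \<in> Z" "B (S z)" for z
  proof -
    have "w1 z - (u (S z) - v (S z)) = (w1 (S z) - u (S z)) - (w2 (S z) - v (S z))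
        + (w2 (S z) - w2 z) - (w1 (S z) - (w1 z + w2 z))" by simp
    then have "w1 z - (u (S z) - v (S z)) \<in> \<int>"
      using S1[OF that(1)] S2[OF that(1)] centered_diff_Ints unfolding u_def v_def by (metis Ints_add Ints_diff)
    then show "u z = u (S z) - v (S z)" unfolding u_def[of z] using that(2)
      unfolding B_def by - (rule centered_eqI, assumption, elim conjE, linarith)
    have "w2 z - v (S z) = (w2 (S z) - v (S z)) - (w2 (S z) - w2 z)" by simp
    then have "w2 z - v (S z) \<in> \<int>"
      using S2[OF that(1)] centered_diff_Ints unfolding v_def by (metis Ints_diff)
    then show "v z = v (S z)" unfolding v_def[of z] using that(2)
      unfolding B_def by - (rule centered_eqI, assumption, elim conjE, linarith)
  qed
  have Tz': "v z = v (T z) - u (T z)" "u z = u (T z)" if "z \<in> Z" "B (T z)" for z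
  proof -
    have "w2 z - (v (T z) - u (T z)) = (w2 (T z) - v (T z)) - (w1 (T z) - u (T z))
        + (w1 (T z) - w1 z) - (w2 (T z) - (w1 z + w2 z))" by simp
    then have "w2 z - (v (T z) - u (T z)) \<in> \<int>"
      using T1[OF that(1)] T2[OF that(1)] centered_diff_Ints unfolding u_def v_def by (metis Ints_add Ints_diff)
    then show "v z = v (T z) - u (T z)" unfolding v_def[of z] using that(2)
      unfolding B_def by - (rule centered_eqI, assumption, elim conjE, linarith)
    have "w1 z - u (T z) = (w1 (T z) - u (T z)) - (w1 (T z) - w1 z)" by simp
    then have "w1 z - u (T z) \<in> \<int>"
      using T1[OF that(1)] centered_diff_Ints unfolding u_def by (metis Ints_diff)
    then show "u z = u (T z)" unfolding u_def[of z] using that(2)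
      unfolding B_def by - (rule centered_eqI, assumption, elim conjE, linarith)
  qed
  have image: "\<mu> P \<le> \<mu> Q + 2/25 * M"
    if R: "bij_betw R Z Z" "l2 (\<lambda>z. f (R z) - f z) Z \<le> 1/25 * l2 f Z"
      and PQ: "\<And>z. z \<in> Z \<Longrightarrow> P z \<Longrightarrow> Q (R z)" for P Q R
  proof -
    have "\<bar>\<mu> Q - \<mu> (\<lambda>z. Q (R z))\<bar> \<le> 2/25 * M" by (rule shift[OF R]) simp
    moreover have "\<mu> P \<le> \<mu> (\<lambda>z. Q (R z))" by (rule mono[OF PQ])
    ultimately show ?thesis by linarith
  qed
  have preimage: "\<mu> P \<le> \<mu> Q + 2/25 * M"
    if R: "bij_betw R Z Z" "l2 (\<lambda>z. f (R z) - f z) Z \<le> 1/25 * l2 f Z"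
      and PQ: "\<And>z. z \<in> Z \<Longrightarrow> P (R z) \<Longrightarrow> Q z" for P Q R
  proof -
    have "\<bar>\<mu> P - \<mu> (\<lambda>z. P (R z))\<bar> \<le> 2/25 * M" by (rule shift[OF R]) simp
    moreover have "\<mu> (\<lambda>z. P (R z)) \<le> \<mu> Q" by (rule mono[OF PQ])
    ultimately show ?thesis by linarith
  qed
  have quad: "x > 0 \<and> y > 0 \<or> x < 0 \<and> y < 0 \<Longrightarrow> 0 < (x + y) * y \<and> \<bar>y\<bar> < \<bar>x + y\<bar>" for x y :: real
    by (auto simp: zero_less_mult_iff)
  \<comment> \<open>Both images of \<open>?D\<close> lie in the quadrants of equal signs, in the
    disjoint parts \<open>?P\<close> and \<open>?Q\<close>. So twice the mass of \<open>?D\<close>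
    is at most its mass plus the fraction \<open>1/625 + 4/25 = 101/625\<close> of
    \<open>M\<close>.\<close>
  have pos: "\<mu> (\<lambda>z. B z \<and> 0 < u z * v z) \<le> 101/625 * M"
  proof -
    let ?D = "\<lambda>z. B z \<and> 0 < u z * v z"
    let ?P = "\<lambda>z. 0 < u z * v z \<and> \<bar>v z\<bar> < \<bar>u z\<bar>" and ?Q = "\<lambda>z. 0 < u z * v z \<and> \<bar>u z\<bar> < \<bar>v z\<bar>"
    have "\<mu> ?D \<le> \<mu> ?P + 2/25 * M"
      by (rule image[OF S kS]) (use quad in \<open>simp add: Sz zero_less_mult_iff\<close>)
    moreover have "\<mu> ?D \<le> \<mu> ?Q + 2/25 * M"
      by (rule image[OF T kT]) (use quad in \<open>auto simp: Tz zero_less_mult_iff\<close>)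
    moreover have "\<mu> ?P + \<mu> ?Q \<le> \<mu> (\<lambda>z. 0 < u z * v z)"
      by (rule disj) auto
    moreover have "\<mu> (\<lambda>z. 0 < u z * v z) \<le> \<mu> ?D + \<mu> (\<lambda>z. \<not> B z)"
      by (rule sub) auto
    ultimately show ?thesis using notB by linarith
  qed
  \<comment> \<open>For opposite signs it is subtraction that enlarges a modulus, so preimages take
    the place of images; the count is the same.\<close>
  have neg: "\<mu> (\<lambda>z. B z \<and> u z * v z < 0) \<le> 101/625 * M"
  proof -
    let ?D = "\<lambda>z. B z \<and> u z * v z < 0"
    let ?P = "\<lambda>z. u z * v z < 0 \<and> \<bar>v z\<bar> < \<bar>u z\<bar>" and ?Q = "\<lambda>z. u z * v z < 0 \<and> \<bar>u z\<bar> < \<bar>v z\<bar>"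
    have "\<mu> ?D \<le> \<mu> ?P + 2/25 * M"
      by (rule preimage[OF S kS]) (auto simp: Sz' mult_less_0_iff)
    moreover have "\<mu> ?D \<le> \<mu> ?Q + 2/25 * M"
      by (rule preimage[OF T kT]) (auto simp: Tz' mult_less_0_iff)
    moreover have "\<mu> ?P + \<mu> ?Q \<le> \<mu> (\<lambda>z. u z * v z < 0)"
      by (rule disj) auto
    moreover have "\<mu> (\<lambda>z. u z * v z < 0) \<le> \<mu> ?D + \<mu> (\<lambda>z. \<not> B z)"
      by (rule sub) auto
    ultimately show ?thesis using notB by linarith
  qed
  have nz': "u z \<noteq> 0 \<or> v z \<noteq> 0" if "z \<in> Z" for z
    using nz[OF that] centered_diff_Ints[of "w1 z"] centered_diff_Ints[of "w2 z"] by (auto simp: u_def v_def)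
  have ptot: "\<mu> (\<lambda>z. 0 < u z * v z) \<le> 102/625 * M"
  proof -
    have "\<mu> (\<lambda>z. 0 < u z * v z) \<le> \<mu> (\<lambda>z. B z \<and> 0 < u z * v z) + \<mu> (\<lambda>z. \<not> B z)"
      by (rule sub) auto
    then show ?thesis using pos notB by linarith
  qed
  \<comment> \<open>One shear takes \<open>(0, v)\<close> to \<open>(v, v)\<close>, the other takes
    \<open>(u, 0)\<close> to \<open>(u, u)\<close>. By \<open>nz'\<close> these lie in the open
    quadrants of equal signs, so the axes carry little mass as well.\<close>
  have ax: "\<mu> (\<lambda>z. B z \<and> u z = 0) \<le> \<mu> (\<lambda>z. 0 < u z * v z) + 2/25 * M"
    by (rule image[OF S kS]) (auto simp: Sz zero_less_mult_iff dest: nz')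
  have ay: "\<mu> (\<lambda>z. B z \<and> v z = 0) \<le> \<mu> (\<lambda>z. 0 < u z * v z) + 2/25 * M"
    by (rule image[OF T kT]) (auto simp: Tz zero_less_mult_iff dest: nz')
  have "M \<le> \<mu> B + \<mu> (\<lambda>z. \<not> B z)" unfolding M by (rule sub) auto
  moreover have "\<mu> B \<le> \<mu> (\<lambda>z. B z \<and> u z * v z \<noteq> 0) + \<mu> (\<lambda>z. B z \<and> u z * v z = 0)"
    by (rule sub) auto
  moreover have "\<mu> (\<lambda>z. B z \<and> u z * v z \<noteq> 0) \<le> \<mu> (\<lambda>z. B z \<and> 0 < u z * v z) + \<mu> (\<lambda>z. B z \<and> u z * v z < 0)"
    by (rule sub) (metis linorder_neqE)
  moreover have "\<mu> (\<lambda>z. B z \<and> u z * v z = 0) \<le> \<mu> (\<lambda>z. B z \<and> u z = 0) + \<mu> (\<lambda>z. B z \<and> v z = 0)"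
    by (rule sub) auto
  \<comment> \<open>The bounds add up to \<open>507/625\<close> of \<open>M\<close>: in units of
    \<open>1/625\<close> these are \<open>1\<close> for the complement of the box,
    \<open>2 * 101\<close> for the quadrants and \<open>2 * (102 + 50)\<close> for the axes.\<close>
  ultimately have "M \<le> 0" using pos neg ax ay ptot notB by linarith
  then show ?thesis by (simp add: M_def)
qed

text \<open>\<open>2 - spectral_gap\<close> bounds the norm of \<open>f + g\<close> for unit vectors at distance at least \<open>1/25\<close>, by
  the parallelogram law.\<close>

definition spectral_gap :: real where "spectral_gap = 2 - sqrt (4 - 1/625)"

lemma spectral_gap_bounds: "0 < spectral_gap" "spectral_gap < 1"
proof -
  have "sqrt (4 - 1/625) < 2" by (rule real_less_lsqrt) auto
  then show "0 < spectral_gap" by (simp add: spectral_gap_def)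
  have "1 < sqrt (4 - 1/625)" by (rule real_less_rsqrt) auto
  then show "spectral_gap < 1" by (simp add: spectral_gap_def)
qed

lemma l2_add_le_of_far:
  assumes "finite Z" "l2 g Z = l2 f Z" "1/25 * l2 f Z \<le> l2 (\<lambda>z. g z - f z) Z"
  shows "l2 (\<lambda>z. f z + g z) Z \<le> (2 - spectral_gap) * l2 f Z"
proof -
  have par: "(cmod (a + b))\<^sup>2 = 2 * (cmod a)\<^sup>2 + 2 * (cmod b)\<^sup>2 - (cmod (b - a))\<^sup>2" for a b
    unfolding cmod_power2 by (simp add: power2_eq_square algebra_simps)
  have sq: "(l2 h Z)\<^sup>2 = (\<Sum>z\<in>Z. (cmod (h z))\<^sup>2)" for h :: "'a \<Rightarrow> complex"
    by (simp add: L2_set_def sum_nonneg)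
  have "(l2 (\<lambda>z. f z + g z) Z)\<^sup>2 = 2 * (l2 f Z)\<^sup>2 + 2 * (l2 g Z)\<^sup>2 - (l2 (\<lambda>z. g z - f z) Z)\<^sup>2"
    unfolding sq par by (simp add: sum.distrib sum_subtractf sum_distrib_left)
  also have "\<dots> \<le> 4 * (l2 f Z)\<^sup>2 - (1/25 * l2 f Z)\<^sup>2"
    using power_mono[OF assms(3), of 2] assms(2) by simp
  also have "\<dots> = ((2 - spectral_gap) * l2 f Z)\<^sup>2"
    by (simp add: spectral_gap_def power_mult_distrib algebra_simps power_divide)
  finally show ?thesis
    by (rule power2_le_imp_le) (use spectral_gap_bounds in simp)
qed

lemma l2_sum5_le:
  "l2 (\<lambda>z. a z + b z + c z + d z + e z) Z \<le> l2 (\<lambda>z. a z + b z) Z + l2 c Z + l2 d Z + l2 e Z"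
  using l2_add_le[of "\<lambda>z. a z + b z" c Z] l2_add_le[of "\<lambda>z. a z + b z + c z" d Z]
    l2_add_le[of "\<lambda>z. a z + b z + c z + d z" e Z] by linarith

text \<open>If \<open>l2 f Z\<close> is not \<open>0\<close>, then
  \<open>no_almost_invariant_vector\<close> yields one of the four nontrivial terms at distance at
  least \<open>1/25 * l2 f Z\<close> from \<open>f\<close>. Pairing it with \<open>f\<close> saves
  \<open>spectral_gap * l2 f Z\<close>, and the triangle inequality handles the other three.\<close>

lemma l2_shear_sum_le:
  fixes w1 w2 :: "'z \<Rightarrow> real" and S T :: "'z \<Rightarrow> 'z" and f :: "'z \<Rightarrow> complex"
  assumes fin: "finite Z" and S: "bij_betw S Z Z" and T: "bij_betw T Z Z"
    and "\<And>z. z \<in> Z \<Longrightarrow> w1 (S z) - (w1 z + w2 z) \<in> \<int>"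
    and "\<And>z. z \<in> Z \<Longrightarrow> w2 (S z) - w2 z \<in> \<int>"
    and "\<And>z. z \<in> Z \<Longrightarrow> w1 (T z) - w1 z \<in> \<int>"
    and "\<And>z. z \<in> Z \<Longrightarrow> w2 (T z) - (w1 z + w2 z) \<in> \<int>"
    and "\<And>z. z \<in> Z \<Longrightarrow> \<not> (w1 z \<in> \<int> \<and> w2 z \<in> \<int>)"
  shows "l2 (\<lambda>z. f z + cis (2 * pi * w1 z) * f z + cis (2 * pi * w2 z) * f z + f (S z) + f (T z)) Z
    \<le> (5 - spectral_gap) * l2 f Z"
proof -
  let ?a = "\<lambda>z. cis (2 * pi * w1 z) * f z" and ?b = "\<lambda>z. cis (2 * pi * w2 z) * f z"
  let ?c = "\<lambda>z. f (S z)" and ?d = "\<lambda>z. f (T z)"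
  let ?all = "\<lambda>z. f z + ?a z + ?b z + ?c z + ?d z"
  have na: "l2 ?a Z = l2 f Z" and nb: "l2 ?b Z = l2 f Z" by (simp_all add: norm_mult)
  have nc: "l2 ?c Z = l2 f Z"
    unfolding L2_set_def using sum.reindex_bij_betw[OF S, of "\<lambda>z. (cmod (f z))\<^sup>2"] by simp
  have nd: "l2 ?d Z = l2 f Z"
    unfolding L2_set_def using sum.reindex_bij_betw[OF T, of "\<lambda>z. (cmod (f z))\<^sup>2"] by simp
  note n = na nb nc nd
  have case1: "l2 ?all Z \<le> (5 - spectral_gap) * l2 f Z"
    if "1/25 * l2 f Z \<le> l2 (\<lambda>z. ?a z - f z) Z"
    using l2_add_le_of_far[OF fin na that] l2_sum5_le[of f ?a ?b ?c ?d Z] n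
    by (simp add: algebra_simps)
  have case2: "l2 ?all Z \<le> (5 - spectral_gap) * l2 f Z"
    if "1/25 * l2 f Z \<le> l2 (\<lambda>z. ?b z - f z) Z"
    using l2_add_le_of_far[OF fin nb that] l2_sum5_le[of f ?b ?a ?c ?d Z] n
    by (simp add: algebra_simps)
  have case3: "l2 ?all Z \<le> (5 - spectral_gap) * l2 f Z"
    if "1/25 * l2 f Z \<le> l2 (\<lambda>z. ?c z - f z) Z"
    using l2_add_le_of_far[OF fin nc that] l2_sum5_le[of f ?c ?a ?b ?d Z] n
    by (simp add: algebra_simps)
  have case4: "l2 ?all Z \<le> (5 - spectral_gap) * l2 f Z"
    if "1/25 * l2 f Z \<le> l2 (\<lambda>z. ?d z - f z) Z"
    using l2_add_le_of_far[OF fin nd that] l2_sum5_le[of f ?d ?a ?b ?c Z] n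
    by (simp add: algebra_simps)
  show ?thesis
  proof (cases "l2 f Z = 0")
    case True
    then show ?thesis using case1 L2_set_nonneg[of "\<lambda>z. cmod (?a z - f z)" Z] by simp
  next
    case False
    then show ?thesis
      using no_almost_invariant_vector[OF assms, of f] case1 case2 case3 case4 by (meson linear)
  qed
qed

section \<open>Unitaries on torsion points of the torus\<close>

definition modulus :: "nat \<Rightarrow> int" where "modulus k = 2 ^ Suc k"

text \<open>The points of exact order \<open>2^(k+1)\<close> in the torus, multiplied by \<open>2^(k+1)\<close>.\<close>

definition torus_pts :: "nat \<Rightarrow> (int \<times> int) set" where
  "torus_pts k = {(x, y). 0 \<le> x \<and> x < modulus k \<and> 0 \<le> y \<and> y < modulus k \<and> \<not> (even x \<and> even y)}"

text \<open>The unitary with index \<open>c\<close> sends \<open>f\<close> to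
  \<open>\<lambda>s. phase k c s * f (shear k c s)\<close>: the identity for \<open>c = 0\<close>,
  coordinate characters for \<open>1\<close> and \<open>2\<close>, shears for \<open>3\<close> and
  \<open>4\<close>.\<close>

definition shear :: "nat \<Rightarrow> nat \<Rightarrow> int \<times> int \<Rightarrow> int \<times> int" where
  "shear k c s = (if c = 3 then ((fst s + snd s) mod modulus k, snd s)
     else if c = 4 then (fst s, (fst s + snd s) mod modulus k) else s)"

definition phase :: "nat \<Rightarrow> nat \<Rightarrow> int \<times> int \<Rightarrow> complex" where
  "phase k c s = (if c = 1 then cis (2 * pi * (real_of_int (fst s) / real_of_int (modulus k)))
     else if c = 2 then cis (2 * pi * (real_of_int (snd s) / real_of_int (modulus k))) else 1)"

lemma modulus_pos: "0 < modulus k" and even_modulus: "even (modulus k)"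
  by (simp_all add: modulus_def)

lemma finite_torus_pts: "finite (torus_pts k)"
proof (rule finite_subset)
  show "torus_pts k \<subseteq> {0..<modulus k} \<times> {0..<modulus k}" by (auto simp: torus_pts_def)
qed simp

lemma torus_pts_nonempty: "torus_pts k \<noteq> {}"
proof -
  have "(1::int) < 2 ^ Suc k" by (rule one_less_power) auto
  then have "(1, 0) \<in> torus_pts k" by (simp add: torus_pts_def modulus_def del: power_Suc)
  then show ?thesis by blast
qed

lemma cmod_phase: "cmod (phase k c s) = 1"
  by (simp add: phase_def)

lemma even_mod_modulus: "even (a mod modulus k) \<longleftrightarrow> even a"
  using even_modulus[of k] by (simp add: dvd_mod_iff)

text \<open>Reduction by the even modulus keeps parities, so a shear keeps the condition that the
  coordinates are not both even. Injectivity then suffices on a finite set.\<close>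

lemma shear_bij: "bij_betw (shear k c) (torus_pts k) (torus_pts k)"
proof -
  have sub: "shear k c ` torus_pts k \<subseteq> torus_pts k"
    using modulus_pos[of k] by (auto simp: shear_def torus_pts_def even_mod_modulus)
  have modeq: "x = x'" if "(x + y) mod modulus k = (x' + y) mod modulus k"
    "0 \<le> x" "x < modulus k" "0 \<le> x'" "x' < modulus k" for x x' y
  proof -
    have "x mod modulus k = x' mod modulus k"
      using mod_diff_cong[OF that(1) refl, of y] by simp
    then show ?thesis using that by simp
  qed
  have modeq': "x = x'" if "(y + x) mod modulus k = (y + x') mod modulus k"
    "0 \<le> x" "x < modulus k" "0 \<le> x'" "x' < modulus k" for x x' y
    using modeq[of x y x'] that by (simp add: add.commute)
  have "inj_on (shear k c) (torus_pts k)"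
    by (auto simp: inj_on_def shear_def torus_pts_def intro: modeq modeq' split: if_splits)
  then show ?thesis
    using endo_inj_surj[OF finite_torus_pts sub] by (simp add: bij_betw_def)
qed

lemma mod_modulus_diff_Ints:
  "real_of_int (a mod modulus k) / real_of_int (modulus k) - real_of_int a / real_of_int (modulus k) \<in> \<int>"
proof -
  have "real_of_int (a mod modulus k) = real_of_int a - real_of_int (modulus k) * real_of_int (a div modulus k)"
    by (metis minus_mult_div_eq_mod of_int_diff of_int_mult)
  then have "real_of_int (a mod modulus k) / real_of_int (modulus k) - real_of_int a / real_of_int (modulus k)
    = - real_of_int (a div modulus k)"
    using modulus_pos[of k] by (simp add: field_simps)
  then show ?thesis by simp
qed

text \<open>Clearing denominators leaves \<open>x\<close> equal to an even multiple of
  \<open>y\<close> plus a multiple of the even number \<open>modulus k\<close>. Applied to both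
  coordinates, this keeps the difference of two points of different exact orders away from
  \<open>0\<close> on the torus.\<close>

lemma even_of_quotient_diff_Ints:
  assumes "l < k" "real_of_int x / real_of_int (modulus k) - real_of_int y / real_of_int (modulus l) \<in> \<int>"
  shows "even x"
proof -
  obtain m where m: "real_of_int x / real_of_int (modulus k) - real_of_int y / real_of_int (modulus l) = of_int m"
    using assms(2) by (auto elim: Ints_cases)
  have N: "modulus k = 2 ^ (k - l) * modulus l"
    using assms(1) by (simp add: modulus_def power_add[symmetric])
  have "real_of_int x = real_of_int (2 ^ (k - l) * y + m * modulus k)"
    using m modulus_pos[of k] modulus_pos[of l] unfolding N by (simp add: field_simps)
  then have "x = 2 ^ (k - l) * y + m * modulus k" by linarith
  moreover have "even ((2::int) ^ (k - l))" using assms(1) by simp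
  ultimately show ?thesis using even_modulus[of k] by simp
qed

text \<open>\<open>l2_shear_sum_le\<close> is applied to pairs of points with their coordinate
  differences \<open>w1\<close> and \<open>w2\<close>: conjugation at level \<open>l\<close> makes
  the product of two characters a character of the difference, simultaneous shears act linearly on
  it, and the different orders keep it off the integer lattice.\<close>

lemma l2_phase_shear_le:
  assumes "l < k"
  shows "l2 (\<lambda>z. \<Sum>c<5. phase k c (fst z) * cnj (phase l c (snd z)) * f (shear k c (fst z), shear l c (snd z)))
      (torus_pts k \<times> torus_pts l) \<le> (5 - spectral_gap) * l2 f (torus_pts k \<times> torus_pts l)"
proof -
  let ?Z = "torus_pts k \<times> torus_pts l"
  define q1 q2 where "q1 j s = real_of_int (fst s) / real_of_int (modulus j)"
    and "q2 j s = real_of_int (snd s) / real_of_int (modulus j)" for j and s :: "int \<times> int"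
  define w1 w2 where "w1 z = q1 k (fst z) - q1 l (snd z)" and "w2 z = q2 k (fst z) - q2 l (snd z)"
    for z :: "(int \<times> int) \<times> int \<times> int"
  define P where "P c = map_prod (shear k c) (shear l c)" for c
  have P: "bij_betw (P c) ?Z ?Z" for c
    unfolding P_def by (intro bij_betw_map_prod shear_bij)
  \<comment> \<open>Levels \<open>k\<close> and \<open>l\<close> each contribute an integer, by
    \<open>q\<close> below; \<open>comb\<close> takes the difference.\<close>
  have comb: "w (P c z) - t \<in> \<int>" if "w (P c z) - t = a - b" "a \<in> \<int>" "b \<in> \<int>"
    for a b t :: real and w :: "_ \<Rightarrow> real" and c z
    using that by (metis Ints_diff)
  have q: "q1 j (shear j 3 s) - (q1 j s + q2 j s) \<in> \<int>" "q2 j (shear j 3 s) - q2 j s \<in> \<int>"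
    "q1 j (shear j 4 s) - q1 j s \<in> \<int>" "q2 j (shear j 4 s) - (q1 j s + q2 j s) \<in> \<int>" for j s
    using mod_modulus_diff_Ints[of "fst s + snd s" j]
    by (simp_all add: q1_def q2_def shear_def add_divide_distrib)
  have "l2 (\<lambda>z. f z + cis (2 * pi * w1 z) * f z + cis (2 * pi * w2 z) * f z + f (P 3 z) + f (P 4 z)) ?Z
    \<le> (5 - spectral_gap) * l2 f ?Z"
  proof (rule l2_shear_sum_le[OF _ P P])
    show "finite ?Z" by (simp add: finite_torus_pts)
  next
    fix z
    show "w1 (P 3 z) - (w1 z + w2 z) \<in> \<int>"
      by (rule comb[OF _ q(1)[of k "fst z"] q(1)[of l "snd z"]]) (simp add: w1_def w2_def P_def)
    show "w2 (P 3 z) - w2 z \<in> \<int>"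
      by (rule comb[OF _ q(2)[of k "fst z"] q(2)[of l "snd z"]]) (simp add: w1_def w2_def P_def)
    show "w1 (P 4 z) - w1 z \<in> \<int>"
      by (rule comb[OF _ q(3)[of k "fst z"] q(3)[of l "snd z"]]) (simp add: w1_def w2_def P_def)
    show "w2 (P 4 z) - (w1 z + w2 z) \<in> \<int>"
      by (rule comb[OF _ q(4)[of k "fst z"] q(4)[of l "snd z"]]) (simp add: w1_def w2_def P_def)
  next
    fix z assume "z \<in> ?Z"
    then have "\<not> (even (fst (fst z)) \<and> even (snd (fst z)))" by (auto simp: torus_pts_def)
    then show "\<not> (w1 z \<in> \<int> \<and> w2 z \<in> \<int>)"
      unfolding w1_def w2_def q1_def q2_def using even_of_quotient_diff_Ints[OF assms] by blast
  qed
  moreover have "(\<Sum>c<5. phase k c (fst z) * cnj (phase l c (snd z)) * f (shear k c (fst z), shear l c (snd z)))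
    = f z + cis (2 * pi * w1 z) * f z + cis (2 * pi * w2 z) * f z + f (P 3 z) + f (P 4 z)" for z
  proof -
    have "phase k 1 (fst z) * cnj (phase l 1 (snd z)) = cis (2 * pi * w1 z)"
      by (simp add: phase_def w1_def q1_def cis_cnj cis_mult right_diff_distrib)
    moreover have "phase k 2 (fst z) * cnj (phase l 2 (snd z)) = cis (2 * pi * w2 z)"
      by (simp add: phase_def w2_def q2_def cis_cnj cis_mult right_diff_distrib)
    moreover have "{..<5::nat} = {0,1,2,3,4}" by auto
    ultimately show ?thesis
      by (simp add: shear_def phase_def[of _ 0] phase_def[of _ 3] phase_def[of _ 4] P_def map_prod_def case_prod_beta add_ac)
  qed
  ultimately show ?thesis by simp
qed

section \<open>The quotient map\<close>

lemma op_norm_cong: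
  assumes "\<And>i j. i \<in> I \<Longrightarrow> j \<in> J \<Longrightarrow> T i j = T' i j"
  shows "op_norm I J T = op_norm I J T'"
proof -
  have "l2 (act J T v) I = l2 (act J T' v) I" for v
    using assms by (intro L2_set_cong) (auto simp: act_def intro!: arg_cong[of _ _ cmod] sum.cong)
  then show ?thesis by (simp add: op_norm_def)
qed

lemma rep_norm_cong:
  assumes "\<And>a b. a < n \<Longrightarrow> b < n \<Longrightarrow> r (x a b) = r (x' a b)"
  shows "rep_norm r S n x = rep_norm r S n x'"
  unfolding rep_norm_def using assms by (intro op_norm_cong) auto

text \<open>A sequence is regarded as a sequence of blocks of length \<open>5\<close>; \<open>wrep\<close> maps its \<open>k\<close>-th block
  \<open>(v\<^sub>c)\<close> to the combination \<open>\<Sum>\<^sub>c v\<^sub>c U\<^sub>c\<close> of the weighted permutation matrices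
  \<open>(U\<^sub>c f)(s) = g\<^sub>c(s) f(h\<^sub>c(s))\<close>.\<close>

definition wrep :: "nat set \<Rightarrow> (nat \<Rightarrow> 's \<Rightarrow> 's) \<Rightarrow> (nat \<Rightarrow> 's \<Rightarrow> complex) \<Rightarrow> nat \<Rightarrow> vec \<Rightarrow> 's \<Rightarrow> 's \<Rightarrow> complex" where
  "wrep C h g k v s t = (\<Sum>c\<in>C. if t = h c s then g c s * v (5 * k + c) else 0)"

text \<open>Row \<open>s\<close> of the weighted permutation matrix with index \<open>c\<close> has
  its only entry in column \<open>h c s\<close>.\<close>

lemma act_wrep:
  assumes "finite S" "\<And>c. c \<in> C \<Longrightarrow> bij_betw (h c) S S" "s \<in> S"
  shows "act ({..<n} \<times> S) (\<lambda>z w. wrep C h g k (x (fst z) (fst w)) (snd z) (snd w)) u (a, s)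
    = (\<Sum>b<n. \<Sum>c\<in>C. g c s * x a b (5 * k + c) * u (b, h c s))"
proof -
  have "(\<Sum>t\<in>S. wrep C h g k v s t * u (b, t)) = (\<Sum>c\<in>C. g c s * v (5 * k + c) * u (b, h c s))" for v b
  proof -
    have "(\<Sum>t\<in>S. wrep C h g k v s t * u (b, t))
      = (\<Sum>c\<in>C. \<Sum>t\<in>S. if t = h c s then g c s * v (5 * k + c) * u (b, t) else 0)"
      unfolding wrep_def sum_distrib_right by (subst sum.swap) (intro sum.cong, auto)
    also have "\<dots> = (\<Sum>c\<in>C. g c s * v (5 * k + c) * u (b, h c s))"
      using assms by (intro sum.cong refl) (auto simp: bij_betw_def)
    finally show ?thesis .
  qed
  then show ?thesis by (simp add: act_def sum.cartesian_product')
qed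

lemma ruan_seminorm_wrep:
  assumes "finite S"
  shows "ruan_seminorm E (rep_norm (wrep C h g k) S)"
proof (rule ruan_seminorm_rep_norm[OF assms])
  fix u v s t
  show "wrep C h g k (vadd u v) s t = wrep C h g k u s t + wrep C h g k v s t"
    unfolding wrep_def sum.distrib[symmetric] by (intro sum.cong) (auto simp: vadd_def algebra_simps)
next
  fix c v s t
  show "wrep C h g k (vsmul c v) s t = c * wrep C h g k v s t"
    unfolding wrep_def sum_distrib_left by (intro sum.cong) (auto simp: vsmul_def)
qed

section \<open>Seminorms of a single block\<close>

text \<open>A crude majorant of all seminorms of block \<open>k\<close>, independent of the
  representation. It converges when the blocks do, and so controls boundedness and null
  sequences.\<close>

definition block_sum :: "nat \<Rightarrow> vec mat \<Rightarrow> nat \<Rightarrow> real" where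
  "block_sum n x k = (\<Sum>a<n. \<Sum>b<n. \<Sum>c<5. cmod (x a b (5 * k + c)))"

text \<open>The operator is a sum of pieces \<open>?t\<close> with one row index \<open>a\<close>,
  one column index \<open>b\<close> and one \<open>c\<close>. Each is a coordinate of
  \<open>x\<close> times a partial permutation with weights of modulus at most \<open>1\<close>, so
  its norm is at most the modulus of that coordinate.\<close>

lemma rep_norm_wrep_le_block_sum:
  fixes S :: "'s set"
  assumes fin: "finite S" and h: "\<And>c. c \<in> C \<Longrightarrow> bij_betw (h c) S S" and C: "C \<subseteq> {..<5}"
    and g: "\<And>c s. cmod (g c s) \<le> 1"
  shows "rep_norm (wrep C h g k) S n x \<le> block_sum n x k"
  unfolding rep_norm_def
proof (rule op_norm_le)
  show "0 \<le> block_sum n x k" by (simp add: block_sum_def sum_nonneg)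
  fix u :: "nat \<times> 's \<Rightarrow> complex"
  let ?I = "{..<n} \<times> S"
  let ?w = "act ?I (\<lambda>z w. wrep C h g k (x (fst z) (fst w)) (snd z) (snd w)) u"
  let ?t = "\<lambda>a b c z. if fst z = a then g c (snd z) * x a b (5 * k + c) * u (b, h c (snd z)) else 0"
  have "l2 ?w ?I = l2 (\<lambda>z. \<Sum>a<n. \<Sum>b<n. \<Sum>c\<in>C. ?t a b c z) ?I"
  proof (rule L2_set_cong[OF refl])
    fix z assume z: "z \<in> ?I"
    have "(\<Sum>a<n. \<Sum>b<n. \<Sum>c\<in>C. ?t a b c z)
      = (\<Sum>a<n. if fst z = a then \<Sum>b<n. \<Sum>c\<in>C. g c (snd z) * x a b (5 * k + c) * u (b, h c (snd z)) else 0)"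
      by (intro sum.cong) auto
    also have "\<dots> = (\<Sum>b<n. \<Sum>c\<in>C. g c (snd z) * x (fst z) b (5 * k + c) * u (b, h c (snd z)))"
      using z by (simp add: mem_Times_iff)
    also have "\<dots> = ?w (fst z, snd z)"
      using z by (intro act_wrep[OF fin h, symmetric]) auto
    finally show "cmod (?w z) = cmod (\<Sum>a<n. \<Sum>b<n. \<Sum>c\<in>C. ?t a b c z)"
      by (simp only: prod.collapse)
  qed
  also have "\<dots> \<le> (\<Sum>a<n. \<Sum>b<n. \<Sum>c\<in>C. l2 (?t a b c) ?I)"
    using finite_subset[OF C]
    by (intro order_trans[OF l2_sum_le] sum_mono) auto
  also have "\<dots> \<le> (\<Sum>a<n. \<Sum>b<n. \<Sum>c\<in>C. cmod (x a b (5 * k + c)) * l2 u ?I)"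
  proof (intro sum_mono)
    fix a b c assume a: "a \<in> {..<n}" and b: "b \<in> {..<n}" and c: "c \<in> C"
    have "(l2 (?t a b c) ?I)\<^sup>2 = (\<Sum>s\<in>S. \<Sum>i<n. (cmod (?t a b c (i, s)))\<^sup>2)"
      unfolding l2_Times by (simp add: L2_set_def sum_nonneg)
    also have "\<dots> = (\<Sum>s\<in>S. (cmod (g c s * x a b (5 * k + c) * u (b, h c s)))\<^sup>2)"
      using a by (simp add: if_distrib[of cmod] if_distrib[of "\<lambda>x. x\<^sup>2"] cong: if_cong)
    also have "\<dots> \<le> (\<Sum>s\<in>S. (cmod (x a b (5 * k + c)))\<^sup>2 * (cmod (u (b, h c s)))\<^sup>2)"
    proof (rule sum_mono)
      fix s
      have "cmod (g c s * x a b (5 * k + c) * u (b, h c s)) \<le> cmod (x a b (5 * k + c)) * cmod (u (b, h c s))"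
        using g[of c s] by (simp add: norm_mult mult_left_le_one_le mult_right_mono)
      then show "(cmod (g c s * x a b (5 * k + c) * u (b, h c s)))\<^sup>2
        \<le> (cmod (x a b (5 * k + c)))\<^sup>2 * (cmod (u (b, h c s)))\<^sup>2"
        unfolding power_mult_distrib[symmetric] by (rule power_mono) simp
    qed
    also have "\<dots> = (cmod (x a b (5 * k + c)))\<^sup>2 * (\<Sum>s\<in>S. (cmod (u (b, s)))\<^sup>2)"
      using sum.reindex_bij_betw[OF h[OF c], of "\<lambda>s. (cmod (u (b, s)))\<^sup>2"] by (simp flip: sum_distrib_left)
    also have "\<dots> \<le> (cmod (x a b (5 * k + c)))\<^sup>2 * (\<Sum>i<n. \<Sum>s\<in>S. (cmod (u (i, s)))\<^sup>2)"
      using b by (intro mult_left_mono member_le_sum) (auto intro: sum_nonneg)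
    also have "\<dots> = (cmod (x a b (5 * k + c)) * l2 u ?I)\<^sup>2"
      by (simp add: power_mult_distrib L2_set_def sum_nonneg sum.cartesian_product case_prod_beta)
    finally show "l2 (?t a b c) ?I \<le> cmod (x a b (5 * k + c)) * l2 u ?I"
      by (rule power2_le_imp_le) simp
  qed
  also have "\<dots> \<le> (\<Sum>a<n. \<Sum>b<n. \<Sum>c<5. cmod (x a b (5 * k + c)) * l2 u ?I)"
    using C by (intro sum_mono sum_mono2) auto
  also have "\<dots> = block_sum n x k * l2 u ?I" by (simp add: block_sum_def sum_distrib_right)
  finally show "l2 ?w ?I \<le> block_sum n x k * l2 u ?I" .
qed

text \<open>For \<open>i < 5\<close> a representation on a single point reads off coordinate
  \<open>i\<close> of the block, which later makes the norms definite; the point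
  \<open>(0, 0)\<close> is chosen to match the type of the torus points. The value
  \<open>i = 5\<close> selects the combination of the unitaries.\<close>

definition block_seminorm :: "nat \<Rightarrow> nat \<Rightarrow> nat \<Rightarrow> vec mat \<Rightarrow> real" where
  "block_seminorm k i = (if i < 5 then rep_norm (wrep {i} (\<lambda>_ s. s) (\<lambda>_ _. 1) k) {(0::int, 0::int)}
     else rep_norm (wrep {..<5} (shear k) (phase k) k) (torus_pts k))"

lemma ruan_seminorm_block_seminorm: "ruan_seminorm E (block_seminorm k i)"
  by (simp add: block_seminorm_def ruan_seminorm_wrep finite_torus_pts)

lemma block_seminorm_le_block_sum: "block_seminorm k i n x \<le> block_sum n x k"
proof (cases "i < 5")
  case True
  then show ?thesis unfolding block_seminorm_def
    by (simp, intro rep_norm_wrep_le_block_sum) (auto simp: bij_betw_def)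
next
  case False
  then show ?thesis unfolding block_seminorm_def
    by (simp, intro rep_norm_wrep_le_block_sum) (auto simp: finite_torus_pts shear_bij cmod_phase)
qed

lemma block_seminorm_nonneg: "0 \<le> block_seminorm k i n x"
  by (simp add: block_seminorm_def rep_norm_def op_norm_nonneg finite_torus_pts)

lemma block_seminorm_cong:
  assumes "\<And>a b c. a < n \<Longrightarrow> b < n \<Longrightarrow> c < 5 \<Longrightarrow> x a b (5 * k + c) = x' a b (5 * k + c)"
  shows "block_seminorm k i n x = block_seminorm k i n x'"
proof -
  have "wrep C h g k (x a b) = wrep C h g k (x' a b)" if "a < n" "b < n" "C \<subseteq> {..<5}"
    for a b C and h :: "nat \<Rightarrow> int \<times> int \<Rightarrow> int \<times> int" and g
    using assms that by (auto simp: wrep_def fun_eq_iff intro!: sum.cong)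
  then show ?thesis unfolding block_seminorm_def by (auto intro!: rep_norm_cong)
qed

lemma cmod_entry_le_block_seminorm:
  assumes "a < n" "b < n" "i < 5"
  shows "cmod (x a b (5 * k + i)) \<le> block_seminorm k i n x"
proof -
  let ?I = "{..<n} \<times> {(0::int, 0::int)}"
  let ?T = "\<lambda>z w. wrep {i} (\<lambda>_ s. s) (\<lambda>_ _. 1) k (x (fst z) (fst w)) (snd z) (snd w)"
  have "cmod (?T (a, (0::int, 0::int)) (b, (0::int, 0::int))) \<le> op_norm ?I ?I ?T"
    by (rule cmod_entry_le_op_norm[where T = ?T]) (use assms in auto)
  then show ?thesis using assms by (simp add: block_seminorm_def rep_norm_def wrep_def)
qed

section \<open>Convergent and constant sequences of blocks and their norms\<close>

text \<open>\<open>K = 0\<close> gives the norm of \<open>E\<close>; discarding the first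
  \<open>K\<close> terms prepares the upper limit.\<close>

definition tail_norm :: "nat \<Rightarrow> nat \<Rightarrow> vec mat \<Rightarrow> real" where
  "tail_norm K n x = (SUP \<alpha>\<in>{K..} \<times> {..5}. block_seminorm (fst \<alpha>) (snd \<alpha>) n x)"

definition conv_space :: "vec set" where
  "conv_space = {v. \<forall>c<5. convergent (\<lambda>k. v (5 * k + c))}"

text \<open>A copy of \<open>\<complex>^5\<close>, realised as the constant sequences of blocks. It
  lies inside \<open>conv_space\<close>, so the limit map becomes idempotent and seminorms of
  \<open>conv_space\<close> restrict to it.\<close>

definition periodic_space :: "vec set" where
  "periodic_space = {v. \<forall>j. v j = v (j mod 5)}"

definition block_limit :: "vec \<Rightarrow> vec" where
  "block_limit v = (\<lambda>j. lim (\<lambda>k. v (5 * k + j mod 5)))"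

text \<open>Tail norms decrease in \<open>K\<close> on \<open>conv_space\<close>, so there the
  infimum is the upper limit over \<open>k\<close> of the largest seminorm of block
  \<open>k\<close>.\<close>

definition limit_norm :: "nat \<Rightarrow> vec mat \<Rightarrow> real" where
  "limit_norm n x = (INF K. tail_norm K n x)"

lemma conv_space_tendsto:
  assumes "v \<in> conv_space" "c < 5"
  shows "(\<lambda>k. v (5 * k + c)) \<longlonglongrightarrow> block_limit v c"
  using assms by (simp add: conv_space_def block_limit_def convergent_LIMSEQ_iff)

lemma conv_space_block_limit_I:
  assumes "\<And>c. c < 5 \<Longrightarrow> (\<lambda>k. v (5 * k + c)) \<longlonglongrightarrow> w c" "w \<in> periodic_space"
  shows "v \<in> conv_space" "block_limit v = w"
proof -
  show "v \<in> conv_space" using assms(1) by (auto simp: conv_space_def convergent_def)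
  show "block_limit v = w"
  proof
    fix j
    have "lim (\<lambda>k. v (5 * k + j mod 5)) = w (j mod 5)" by (rule limI[OF assms(1)]) simp
    then show "block_limit v j = w j" using assms(2) by (simp add: block_limit_def periodic_space_def)
  qed
qed

text \<open>Convergence does not enter: the value at \<open>j\<close> depends on
  \<open>j mod 5\<close> alone.\<close>

lemma block_limit_in_periodic_space: "block_limit v \<in> periodic_space"
  by (simp add: block_limit_def periodic_space_def)

lemma csubsp_periodic_space: "csubsp periodic_space"
  unfolding csubsp_def periodic_space_def vzero_def vadd_def vsmul_def by auto

lemma periodic_space_block_limit: assumes "v \<in> periodic_space" shows "v \<in> conv_space" "block_limit v = v"
proof -
  have "v (5 * k + c) = v c" if "c < 5" for k c
  proof -
    have "v (5 * k + c) = v ((5 * k + c) mod 5)" using assms unfolding periodic_space_def by blast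
    then show ?thesis using that by simp
  qed
  then have "(\<lambda>k. v (5 * k + c)) \<longlonglongrightarrow> v c" if "c < 5" for c using that by simp
  then show "v \<in> conv_space" "block_limit v = v" using conv_space_block_limit_I[OF _ assms] by blast+
qed

lemma block_limit_vadd:
  assumes "u \<in> conv_space" "v \<in> conv_space"
  shows "vadd u v \<in> conv_space" "block_limit (vadd u v) = vadd (block_limit u) (block_limit v)"
proof -
  have "(\<lambda>k. vadd u v (5 * k + c)) \<longlonglongrightarrow> vadd (block_limit u) (block_limit v) c" if "c < 5" for c
    unfolding vadd_def using assms that by (intro tendsto_add conv_space_tendsto)
  moreover have "vadd (block_limit u) (block_limit v) \<in> periodic_space"
    using csubsp_periodic_space block_limit_in_periodic_space by (simp add: csubsp_def)
  ultimately show "vadd u v \<in> conv_space" "block_limit (vadd u v) = vadd (block_limit u) (block_limit v)"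
    using conv_space_block_limit_I by blast+
qed

lemma block_limit_vsmul:
  assumes "v \<in> conv_space"
  shows "vsmul c v \<in> conv_space" "block_limit (vsmul c v) = vsmul c (block_limit v)"
proof -
  have "(\<lambda>k. vsmul c v (5 * k + i)) \<longlonglongrightarrow> vsmul c (block_limit v) i" if "i < 5" for i
    unfolding vsmul_def using assms that by (intro tendsto_mult_left conv_space_tendsto)
  moreover have "vsmul c (block_limit v) \<in> periodic_space"
    using csubsp_periodic_space block_limit_in_periodic_space by (simp add: csubsp_def)
  ultimately show "vsmul c v \<in> conv_space" "block_limit (vsmul c v) = vsmul c (block_limit v)"
    using conv_space_block_limit_I by blast+
qed

lemma csubsp_conv_space: "csubsp conv_space"
proof -
  have "vzero \<in> conv_space" using csubsp_periodic_space periodic_space_block_limit(1) by (simp add: csubsp_def)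
  then show ?thesis using block_limit_vadd(1) block_limit_vsmul(1) by (simp add: csubsp_def)
qed

lemma block_sum_tendsto:
  assumes "x \<in> matset conv_space n n"
  shows "block_sum n x \<longlonglongrightarrow> (\<Sum>a<n. \<Sum>b<n. \<Sum>c<5. cmod (block_limit (x a b) c))"
proof -
  have "x a b \<in> conv_space" if "a < n" "b < n" for a b using assms that by (auto simp: matset_def)
  then have "(\<lambda>k. block_sum n x k) \<longlonglongrightarrow> (\<Sum>a<n. \<Sum>b<n. \<Sum>c<5. cmod (block_limit (x a b) c))"
    unfolding block_sum_def by (intro tendsto_sum tendsto_norm conv_space_tendsto) auto
  then show ?thesis by simp
qed

lemma block_seminorm_bdd_above:
  assumes "x \<in> matset conv_space n n"
  shows "bdd_above ((\<lambda>\<alpha>. block_seminorm (fst \<alpha>) (snd \<alpha>) n x) ` A)"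
proof -
  have "Bseq (block_sum n x)" using block_sum_tendsto[OF assms] convergent_def convergent_imp_Bseq by blast
  then obtain M where "\<And>k. norm (block_sum n x k) \<le> M" by (auto simp: Bseq_def)
  then have "block_seminorm (fst \<alpha>) (snd \<alpha>) n x \<le> M" for \<alpha>
    using block_seminorm_le_block_sum[of "fst \<alpha>" "snd \<alpha>" n x] by (smt (verit) real_norm_def)
  then show ?thesis by (intro bdd_aboveI2) auto
qed

lemma block_seminorm_le_tail_norm:
  assumes "x \<in> matset conv_space n n" "K \<le> k" "i \<le> 5"
  shows "block_seminorm k i n x \<le> tail_norm K n x"
  unfolding tail_norm_def
  using cSUP_upper[OF _ block_seminorm_bdd_above[OF assms(1)], of "(k, i)" "{K..} \<times> {..5}"] assms by simp

lemma tail_norm_le: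
  assumes "\<And>k i. K \<le> k \<Longrightarrow> i \<le> 5 \<Longrightarrow> block_seminorm k i n x \<le> M"
  shows "tail_norm K n x \<le> M"
  unfolding tail_norm_def using assms by (intro cSUP_least) auto

lemma tail_norm_nonneg: "x \<in> matset conv_space n n \<Longrightarrow> 0 \<le> tail_norm K n x"
  using block_seminorm_le_tail_norm[of x n K K 0] block_seminorm_nonneg[of K 0 n x] by simp

lemma tail_norm_antimono:
  assumes "x \<in> matset conv_space n n" "K \<le> L"
  shows "tail_norm L n x \<le> tail_norm K n x"
  using assms by (intro tail_norm_le block_seminorm_le_tail_norm) auto

lemma ruan_seminorm_tail_norm: "ruan_seminorm conv_space (tail_norm K)"
proof -
  have "tail_norm K = (\<lambda>n x. SUP \<alpha>\<in>{K..} \<times> {..5}. block_seminorm (fst \<alpha>) (snd \<alpha>) n x)"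
    by (intro ext) (simp add: tail_norm_def)
  then show ?thesis
    by (simp only:) (rule ruan_seminorm_SUP, auto simp: csubsp_conv_space ruan_seminorm_block_seminorm intro: block_seminorm_bdd_above)
qed

lemma limit_norm_le_tail_norm: "x \<in> matset conv_space n n \<Longrightarrow> limit_norm n x \<le> tail_norm K n x"
  unfolding limit_norm_def by (rule cINF_lower) (auto intro!: bdd_belowI2 tail_norm_nonneg)

lemma tail_norm_tendsto_limit_norm:
  assumes "x \<in> matset conv_space n n"
  shows "(\<lambda>K. tail_norm K n x) \<longlonglongrightarrow> limit_norm n x"
  unfolding limit_norm_def
  by (rule LIMSEQ_decseq_INF)
     (auto intro!: bdd_belowI2 tail_norm_nonneg[OF assms] decseq_SucI tail_norm_antimono[OF assms])

lemma ruan_seminorm_limit_norm: "ruan_seminorm conv_space limit_norm"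
  by (rule ruan_seminorm_lim[OF csubsp_conv_space ruan_seminorm_tail_norm tail_norm_tendsto_limit_norm])

lemma matset_mono: "F \<subseteq> E \<Longrightarrow> x \<in> matset F n n \<Longrightarrow> x \<in> matset E n n"
  by (auto simp: matset_def)

lemma periodic_space_subset_conv_space: "periodic_space \<subseteq> conv_space"
  using periodic_space_block_limit(1) by blast

lemma cmod_entry_le_tail_norm:
  assumes "x \<in> matset conv_space n n" "a < n" "b < n"
  shows "cmod (x a b j) \<le> tail_norm 0 n x"
  using cmod_entry_le_block_seminorm[of a n b "j mod 5" x "j div 5"] block_seminorm_le_tail_norm[OF assms(1), of 0 "j div 5" "j mod 5"]
    assms by (smt (verit) mod_less_divisor mult_div_mod_eq zero_less_numeral le0 less_imp_le_nat)

text \<open>By periodicity every coordinate recurs in block \<open>K\<close> for each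
  \<open>K\<close>. On \<open>conv_space\<close> this fails, as the limit norm vanishes on sequences
  with limit \<open>0\<close>.\<close>

lemma cmod_entry_le_limit_norm:
  assumes "x \<in> matset periodic_space n n" "a < n" "b < n"
  shows "cmod (x a b j) \<le> limit_norm n x"
  unfolding limit_norm_def
proof (rule cINF_greatest)
  fix K
  have xE: "x \<in> matset conv_space n n" using assms(1) periodic_space_subset_conv_space matset_mono by blast
  have "x a b \<in> periodic_space" using assms by (auto simp: matset_def)
  then have "x a b j = x a b (j mod 5)" "x a b (5 * K + j mod 5) = x a b ((5 * K + j mod 5) mod 5)"
    unfolding periodic_space_def by blast+
  then have "x a b j = x a b (5 * K + j mod 5)" by simp
  then show "cmod (x a b j) \<le> tail_norm K n x"
    using cmod_entry_le_block_seminorm[of a n b "j mod 5" x K] block_seminorm_le_tail_norm[OF xE, of K K "j mod 5"] assms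
    by (smt (verit) mod_less_divisor zero_less_numeral le_refl less_imp_le_nat)
qed simp

section \<open>Completeness\<close>

text \<open>\<open>lower\<close> and \<open>upper\<close> make the norm of the first level
  equivalent to the supremum norm of sequences, so a Cauchy sequence converges uniformly;
  \<open>closed\<close> keeps the limit in \<open>G\<close>.\<close>

lemma banach_operator_spaceI:
  assumes os: "operator_space G N"
    and lower: "\<And>v j. v \<in> G \<Longrightarrow> cmod (v j) \<le> N 1 (e11 v)"
    and upper: "\<And>v M. v \<in> G \<Longrightarrow> (\<And>j. cmod (v j) \<le> M) \<Longrightarrow> N 1 (e11 v) \<le> C * M"
    and C: "0 < C"
    and closed: "\<And>(s :: nat \<Rightarrow> vec) v. (\<And>k. s k \<in> G) \<Longrightarrow> (\<And>e. e > 0 \<Longrightarrow> \<exists>K. \<forall>k\<ge>K. \<forall>j. cmod (s k j - v j) \<le> e) \<Longrightarrow> v \<in> G"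
  shows "banach_operator_space G N"
proof -
  have sub: "csubsp G" using os by (simp add: operator_space_def)
  have diff: "vdiff u v \<in> G" if "u \<in> G" "v \<in> G" for u v
    using sub that by (simp add: csubsp_def vdiff_def)
  have vd: "vdiff u v j = u j - v j" for u v j
    by (simp add: vdiff_def vadd_def vsmul_def)
  have "\<exists>v\<in>G. (\<lambda>k. N 1 (e11 (vdiff (s k) v))) \<longlonglongrightarrow> 0"
    if s: "\<And>k. s k \<in> G" and cauchy: "\<And>e. e > 0 \<Longrightarrow> \<exists>K. \<forall>k\<ge>K. \<forall>l\<ge>K. N 1 (e11 (vdiff (s k) (s l))) < e"
    for s
  proof -
    have ptw: "\<exists>K. \<forall>k\<ge>K. \<forall>l\<ge>K. \<forall>j. cmod (s k j - s l j) < e" if "e > 0" for e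
      using cauchy[OF that] lower[OF diff[OF s s]] unfolding vd by (meson le_less_trans)
    have "Cauchy (\<lambda>k. s k j)" for j
      unfolding Cauchy_def dist_norm using ptw by meson
    then have lim: "(\<lambda>k. s k j) \<longlonglongrightarrow> lim (\<lambda>k. s k j)" for j
      by (simp add: Cauchy_convergent_iff convergent_LIMSEQ_iff)
    define v where "v j = lim (\<lambda>k. s k j)" for j
    have unif: "\<exists>K. \<forall>k\<ge>K. \<forall>j. cmod (s k j - v j) \<le> e" if "e > 0" for e
    proof -
      obtain K where K: "\<And>k l j. k \<ge> K \<Longrightarrow> l \<ge> K \<Longrightarrow> cmod (s k j - s l j) < e"
        using ptw[OF \<open>e > 0\<close>] by blast
      have "cmod (s k j - v j) \<le> e" if "k \<ge> K" for k j
      proof (rule LIMSEQ_le_const2)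
        show "(\<lambda>l. cmod (s k j - s l j)) \<longlonglongrightarrow> cmod (s k j - v j)"
          unfolding v_def by (intro tendsto_norm tendsto_diff tendsto_const lim)
        show "\<exists>N. \<forall>n\<ge>N. cmod (s k j - s n j) \<le> e" using K[OF that] less_imp_le by blast
      qed
      then show ?thesis by blast
    qed
    then have vG: "v \<in> G" using closed[of s v] s by blast
    have "(\<lambda>k. N 1 (e11 (vdiff (s k) v))) \<longlonglongrightarrow> 0"
    proof (rule LIMSEQ_I)
      fix r :: real assume r: "r > 0"
      then have "r / (2 * C) > 0" using C by simp
      from unif[OF this] obtain K where K: "\<And>k j. k \<ge> K \<Longrightarrow> cmod (s k j - v j) \<le> r / (2 * C)" by blast
      have "norm (N 1 (e11 (vdiff (s k) v)) - 0) < r" if "k \<ge> K" for k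
      proof -
        have "N 1 (e11 (vdiff (s k) v)) \<le> C * (r / (2 * C))"
          by (rule upper[OF diff[OF s vG]]) (use K[OF that] in \<open>simp add: vd\<close>)
        also have "\<dots> < r" using C r by simp
        finally have "N 1 (e11 (vdiff (s k) v)) < r" .
        moreover have "0 \<le> N 1 (e11 (vdiff (s k) v))"
          by (rule order_trans[OF norm_ge_zero lower[OF diff[OF s vG]]])
        ultimately show ?thesis by simp
      qed
      then show "\<exists>K. \<forall>k\<ge>K. norm (N 1 (e11 (vdiff (s k) v)) - 0) < r" by blast
    qed
    then show ?thesis using vG by blast
  qed
  then show ?thesis unfolding banach_operator_space_def using os by blast
qed

lemma e11_in_matset: "csubsp G \<Longrightarrow> v \<in> G \<Longrightarrow> e11 v \<in> matset G 1 1"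
  by (auto simp: matset_def e11_def csubsp_def)

text \<open>The factor counts the coordinates of a block, through \<open>block_sum\<close>.\<close>

lemma tail_norm_e11_le:
  assumes "\<And>j. cmod (v j) \<le> M"
  shows "tail_norm K 1 (e11 v) \<le> 5 * M"
proof (rule tail_norm_le)
  fix k i
  have "block_sum 1 (e11 v) k = (\<Sum>c<5. cmod (v (5 * k + c)))" by (simp add: block_sum_def e11_def)
  also have "\<dots> \<le> (\<Sum>c<5::nat. M)" by (intro sum_mono assms)
  finally have "block_sum 1 (e11 v) k \<le> 5 * M" by simp
  then show "block_seminorm k i 1 (e11 v) \<le> 5 * M" using block_seminorm_le_block_sum[of k i 1 "e11 v"] by linarith
qed

lemma banach_conv_space: "banach_operator_space conv_space (tail_norm 0)"
proof (rule banach_operator_spaceI[where C = 5])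
  show "operator_space conv_space (tail_norm 0)"
    by (rule operator_spaceI[OF csubsp_conv_space ruan_seminorm_tail_norm cmod_entry_le_tail_norm])
next
  fix v j assume v: "v \<in> conv_space"
  show "cmod (v j) \<le> tail_norm 0 1 (e11 v)"
    using cmod_entry_le_tail_norm[OF e11_in_matset[OF csubsp_conv_space v], of 0 0 j] by (simp add: e11_def)
next
  fix s :: "nat \<Rightarrow> vec" and v
  assume s: "\<And>k. s k \<in> conv_space" and unif: "\<And>e. e > 0 \<Longrightarrow> \<exists>K. \<forall>k\<ge>K. \<forall>j. cmod (s k j - v j) \<le> e"
  have "Cauchy (\<lambda>k. v (5 * k + c))" if c: "c < 5" for c
  proof (rule metric_CauchyI)
    fix e :: real assume e: "e > 0"
    then obtain K where K: "\<And>k j. k \<ge> K \<Longrightarrow> cmod (s k j - v j) \<le> e / 4"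
      using unif[of "e / 4"] by auto
    have "Cauchy (\<lambda>k. s K (5 * k + c))"
      using s[of K] c by (simp add: conv_space_def Cauchy_convergent_iff)
    then obtain M where M: "\<And>m n. m \<ge> M \<Longrightarrow> n \<ge> M \<Longrightarrow> dist (s K (5 * m + c)) (s K (5 * n + c)) < e / 4"
      using e unfolding Cauchy_def by (metis zero_less_divide_iff zero_less_numeral)
    have "dist (v (5 * m + c)) (v (5 * n + c)) < e" if "m \<ge> M" "n \<ge> M" for m n
    proof -
      have "dist (v (5 * m + c)) (v (5 * n + c)) \<le> dist (v (5 * m + c)) (s K (5 * m + c))
         + dist (s K (5 * m + c)) (s K (5 * n + c)) + dist (s K (5 * n + c)) (v (5 * n + c))"
        using dist_triangle[of "v (5 * m + c)" "v (5 * n + c)" "s K (5 * m + c)"]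
          dist_triangle[of "s K (5 * m + c)" "v (5 * n + c)" "s K (5 * n + c)"] by linarith
      moreover have "dist (v (5 * m + c)) (s K (5 * m + c)) \<le> e / 4"
        using K[OF order_refl, of "5 * m + c"] by (simp add: dist_norm norm_minus_commute)
      moreover have "dist (s K (5 * n + c)) (v (5 * n + c)) \<le> e / 4"
        using K[OF order_refl, of "5 * n + c"] by (simp add: dist_norm)
      ultimately show ?thesis using M[OF that] e by linarith
    qed
    then show "\<exists>M. \<forall>m\<ge>M. \<forall>n\<ge>M. dist (v (5 * m + c)) (v (5 * n + c)) < e" by blast
  qed
  then show "v \<in> conv_space" by (simp add: conv_space_def Cauchy_convergent_iff)
qed (use tail_norm_e11_le in auto)

lemma banach_periodic_space: "banach_operator_space periodic_space limit_norm"
proof (rule banach_operator_spaceI[where C = 5])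
  show "operator_space periodic_space limit_norm"
    by (rule operator_spaceI[OF csubsp_periodic_space ruan_seminorm_subset[OF ruan_seminorm_limit_norm periodic_space_subset_conv_space] cmod_entry_le_limit_norm])
next
  fix v j assume v: "v \<in> periodic_space"
  show "cmod (v j) \<le> limit_norm 1 (e11 v)"
    using cmod_entry_le_limit_norm[OF e11_in_matset[OF csubsp_periodic_space v], of 0 0 j] by (simp add: e11_def)
next
  fix v M assume v: "v \<in> periodic_space" and "\<And>j. cmod (v j) \<le> M"
  then have "tail_norm 0 1 (e11 v) \<le> 5 * M" by (intro tail_norm_e11_le)
  moreover have "limit_norm 1 (e11 v) \<le> tail_norm 0 1 (e11 v)"
    using e11_in_matset[OF csubsp_conv_space] v periodic_space_subset_conv_space by (intro limit_norm_le_tail_norm) blast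
  ultimately show "limit_norm 1 (e11 v) \<le> 5 * M" by linarith
next
  fix s :: "nat \<Rightarrow> vec" and v
  assume s: "\<And>k. s k \<in> periodic_space" and unif: "\<And>e. e > 0 \<Longrightarrow> \<exists>K. \<forall>k\<ge>K. \<forall>j. cmod (s k j - v j) \<le> e"
  have lim: "(\<lambda>k. s k j) \<longlonglongrightarrow> v j" for j
  proof (rule LIMSEQ_I)
    fix r :: real assume "r > 0"
    then obtain K where K: "\<And>k j. k \<ge> K \<Longrightarrow> cmod (s k j - v j) \<le> r / 2" using unif[of "r / 2"] by auto
    have "cmod (s k j - v j) < r" if "k \<ge> K" for k
      using \<open>r > 0\<close> K[OF that, of j] by linarith
    then show "\<exists>K. \<forall>k\<ge>K. cmod (s k j - v j) < r" by blast
  qed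
  have per: "s k j = s k (j mod 5)" for k j using s[of k] unfolding periodic_space_def by blast
  have "v j = v (j mod 5)" for j
  proof -
    have "(\<lambda>k. s k (j mod 5)) \<longlonglongrightarrow> v j"
      using lim[of j] by (simp only: per[of _ j, symmetric])
    then show ?thesis using lim[of "j mod 5"] LIMSEQ_unique by blast
  qed
  then show "v \<in> periodic_space" unfolding periodic_space_def by blast
qed simp

section \<open>The limit as a complete quotient map\<close>

text \<open>A lift of \<open>y\<close> differs from the constant sequence \<open>y\<close> by blocks
  tending to \<open>0\<close>, so its norm is at least the limit norm of \<open>y\<close>.
  Conversely, \<open>y\<close> with its first \<open>K\<close> blocks set to \<open>0\<close> is a
  lift of norm at most \<open>tail_norm K n y\<close>.\<close>

lemma complete_quotient_block_limit: "complete_quotient conv_space (tail_norm 0) periodic_space limit_norm block_limit"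
proof -
  have lin: "clinear_on conv_space block_limit"
    using block_limit_vadd(2) block_limit_vsmul(2) by (simp add: clinear_on_def)
  have im: "block_limit ` conv_space = periodic_space"
    using periodic_space_block_limit block_limit_in_periodic_space by (metis image_eqI image_subsetI subsetI subset_antisym)
  let ?ker = "{v \<in> conv_space. block_limit v = vzero}"
  have "limit_norm n (amp block_limit n x) = Inf {tail_norm 0 n (madd x k) | k. k \<in> matset ?ker n n}"
    if n: "n \<ge> 1" and x: "x \<in> matset conv_space n n" for n x
  proof -
    let ?y = "amp block_limit n x"
    let ?Q = "{tail_norm 0 n (madd x k) | k. k \<in> matset ?ker n n}"
    have yF: "?y \<in> matset periodic_space n n" by (simp add: matset_def amp_def block_limit_in_periodic_space)
    have yE: "?y \<in> matset conv_space n n" by (rule matset_mono[OF periodic_space_subset_conv_space yF])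
    have xE: "x a b \<in> conv_space" if "a < n" "b < n" for a b using x that by (simp add: matset_def)
    have kerE: "k \<in> matset conv_space n n" if "k \<in> matset ?ker n n" for k
      by (rule matset_mono[OF _ that]) auto
    have z0: "vzero \<in> ?ker"
    proof -
      have "vzero \<in> periodic_space" using csubsp_periodic_space by (simp add: csubsp_def)
      then show ?thesis using periodic_space_block_limit[of vzero] by simp
    qed
    have ne: "?Q \<noteq> {}"
    proof -
      have "(\<lambda>i j. vzero) \<in> matset ?ker n n" using z0 by (simp add: matset_def)
      then show ?thesis by blast
    qed
    have bel: "bdd_below ?Q"
      using tail_norm_nonneg matset_closed(1)[OF csubsp_conv_space x kerE] by (intro bdd_belowI[of _ 0]) auto
    show ?thesis
    proof (rule antisym)
      show "limit_norm n ?y \<le> Inf ?Q"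
      proof (rule cInf_greatest[OF ne])
        fix t assume "t \<in> ?Q"
        then obtain k where k: "k \<in> matset ?ker n n" and t: "t = tail_norm 0 n (madd x k)" by blast
        define z where "z = madd x k"
        define d where "d = madd ?y (msmul (-1) z)"
        have zE: "z \<in> matset conv_space n n" unfolding z_def by (intro matset_closed csubsp_conv_space x kerE k)
        have dE: "d \<in> matset conv_space n n" unfolding d_def by (intro matset_closed csubsp_conv_space yE zE)
        have yzd: "?y = madd z d"
          by (simp add: d_def madd_def msmul_def vadd_def vsmul_def)
        have "block_limit (d a b) = vzero" if "a < n" "b < n" for a b
        proof -
          have kab: "k a b \<in> conv_space" "block_limit (k a b) = vzero" using k that by (auto simp: matset_def)
          have "block_limit (z a b) = block_limit (x a b)"
            using block_limit_vadd(2)[OF xE[OF that] kab(1)] kab(2) by (simp add: z_def madd_def vadd_def vzero_def)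
          moreover have "z a b \<in> conv_space" using zE that by (simp add: matset_def)
          moreover have "d a b = vadd (block_limit (x a b)) (vsmul (-1) (z a b))"
            using that by (simp add: d_def madd_def msmul_def amp_def)
          ultimately have "block_limit (d a b) = vadd (block_limit (x a b)) (vsmul (-1) (block_limit (x a b)))"
            using block_limit_vadd(2)[of "block_limit (x a b)" "vsmul (-1) (z a b)"] block_limit_vsmul[of "z a b" "-1"]
              periodic_space_block_limit[OF block_limit_in_periodic_space] by simp
          then show ?thesis by (simp add: vadd_def vsmul_def vzero_def)
        qed
        then have tot0: "block_sum n d \<longlonglongrightarrow> 0"
          using block_sum_tendsto[OF dE] by (simp add: vzero_def)
        show "limit_norm n ?y \<le> t"
        proof (rule field_le_epsilon)
          fix e :: real assume "e > 0"
          then obtain K where K: "\<And>k. k \<ge> K \<Longrightarrow> norm (block_sum n d k) < e"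
            using LIMSEQ_D[OF tot0, of e] by auto
          have "block_seminorm k i n d \<le> e" if "k \<ge> K" for k i
            using K[OF that] block_seminorm_le_block_sum[of k i n d] by auto
          then have "tail_norm K n d \<le> e" by (intro tail_norm_le)
          moreover have "limit_norm n ?y \<le> tail_norm K n ?y" by (rule limit_norm_le_tail_norm[OF yE])
          moreover have "tail_norm K n ?y \<le> tail_norm K n z + tail_norm K n d"
            using ruan_seminormD(2)[OF ruan_seminorm_tail_norm n zE dE, of K] by (simp only: yzd[symmetric])
          moreover have "tail_norm K n z \<le> tail_norm 0 n z" by (rule tail_norm_antimono[OF zE]) simp
          ultimately show "limit_norm n ?y \<le> t + e" by (simp add: t z_def)
        qed
      qed
      show "Inf ?Q \<le> limit_norm n ?y"
        unfolding limit_norm_def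
      proof (rule cINF_greatest)
        fix K
        \<comment> \<open>Blocks have length \<open>5\<close>, so \<open>5 * K\<close> coordinates
          are erased. The erased blocks have seminorm \<open>0\<close>, and the later ones agree
          with those of \<open>?y\<close>.\<close>
        define z where "z a b = (\<lambda>j. if j < 5 * K then 0 else ?y a b j)" for a b
        define k where "k = madd z (msmul (-1) x)"
        have zlim: "z a b \<in> conv_space \<and> block_limit (z a b) = ?y a b" for a b
        proof -
          have F: "?y a b \<in> periodic_space"
            using block_limit_in_periodic_space csubsp_periodic_space by (simp add: amp_def csubsp_def)
          have "(\<lambda>k. z a b (5 * k + c)) \<longlonglongrightarrow> ?y a b c" if "c < 5" for c
          proof (rule Lim_transform_eventually)
            show "(\<lambda>k. ?y a b (5 * k + c)) \<longlonglongrightarrow> ?y a b c"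
              using conv_space_tendsto[OF periodic_space_block_limit(1)[OF F] that] periodic_space_block_limit(2)[OF F] by simp
            show "\<forall>\<^sub>F k in sequentially. ?y a b (5 * k + c) = z a b (5 * k + c)"
              using eventually_ge_at_top[of K] by eventually_elim (simp add: z_def)
          qed
          then show ?thesis using conv_space_block_limit_I[OF _ F] by blast
        qed
        have zE: "z \<in> matset conv_space n n"
          using zlim by (auto simp: matset_def z_def amp_def vzero_def)
        have kE: "k \<in> matset conv_space n n" unfolding k_def by (intro matset_closed csubsp_conv_space x zE)
        have "block_limit (k a b) = vzero" if "a < n" "b < n" for a b
        proof -
          have "block_limit (k a b) = vadd (?y a b) (vsmul (-1) (block_limit (x a b)))"
            using zlim[of a b] xE[OF that] block_limit_vadd(2) block_limit_vsmul by (simp add: k_def madd_def msmul_def)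
          then show ?thesis using that by (simp add: amp_def vadd_def vsmul_def vzero_def)
        qed
        then have kker: "k \<in> matset ?ker n n" using kE by (simp add: matset_def)
        have "madd x k = z" by (simp add: k_def madd_def msmul_def vadd_def vsmul_def)
        then have "Inf ?Q \<le> tail_norm 0 n z" using kker bel by (intro cInf_lower) auto
        also have "\<dots> \<le> tail_norm K n ?y"
        proof (rule tail_norm_le)
          fix k i :: nat assume "i \<le> 5"
          show "block_seminorm k i n z \<le> tail_norm K n ?y"
          proof (cases "k < K")
            case True
            then have "block_sum n z k = 0" by (simp add: block_sum_def z_def)
            then show ?thesis using block_seminorm_le_block_sum[of k i n z] tail_norm_nonneg[OF yE, of K] by linarith
          next
            case False
            then have "block_seminorm k i n z = block_seminorm k i n ?y" by (intro block_seminorm_cong) (simp add: z_def)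
            then show ?thesis using block_seminorm_le_tail_norm[OF yE _ \<open>i \<le> 5\<close>, of K k] False by simp
          qed
        qed
        finally show "Inf ?Q \<le> tail_norm K n ?y" .
      qed simp
    qed
  qed
  then show ?thesis unfolding complete_quotient_def using lin im by blast
qed

section \<open>Vectors of a finite-dimensional space from finitely many coordinates\<close>

text \<open>Elimination with coordinates as pivots: the dual system \<open>g\<close> gains a pivot
  whenever the next vector is not yet interpolated. On a finite-dimensional space every coordinate
  thus becomes a fixed linear function of finitely many coordinates, bounded by the norm at every
  matrix level.\<close>

lemma interpolation_points:
  assumes "csubsp V" "finite B" "B \<subseteq> V"
  shows "\<exists>P g. finite P \<and> (\<forall>p\<in>P. g p \<in> V) \<and> (\<forall>p\<in>P. \<forall>p'\<in>P. g p p' = (if p' = p then 1 else 0)) \<and>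
    (\<forall>v\<in>B. \<forall>j. v j = (\<Sum>p\<in>P. v p * g p j))"
  using assms(2,3)
proof (induction B rule: finite_induct)
  case empty
  then show ?case by (intro exI[of _ "{}"]) auto
next
  case (insert b B)
  have "B \<subseteq> V" using insert.prems by blast
  from insert.IH[OF this] obtain P g where P: "finite P" and "\<forall>p\<in>P. g p \<in> V"
    and "\<forall>p\<in>P. \<forall>p'\<in>P. g p p' = (if p' = p then 1 else 0)"
    and "\<forall>v\<in>B. \<forall>j. v j = (\<Sum>p\<in>P. v p * g p j)"
    by blast
  then have gV: "\<And>p. p \<in> P \<Longrightarrow> g p \<in> V"
    and dual: "\<And>p p'. p \<in> P \<Longrightarrow> p' \<in> P \<Longrightarrow> g p p' = (if p' = p then 1 else 0)"
    and rep: "\<And>v j. v \<in> B \<Longrightarrow> v j = (\<Sum>p\<in>P. v p * g p j)"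
    by blast+
  \<comment> \<open>The interpolation error of \<open>b\<close>. By duality it vanishes on
    \<open>P\<close>, so a position where it is nonzero is a new pivot.\<close>
  define r where "r j = b j - (\<Sum>p\<in>P. b p * g p j)" for j
  have rP: "r p = 0" if "p \<in> P" for p
  proof -
    have "(\<Sum>q\<in>P. b q * g q p) = (\<Sum>q\<in>P. if q = p then b q else 0)"
      using that by (intro sum.cong) (auto simp: dual)
    then show ?thesis using that P by (simp add: r_def)
  qed
  show ?case
  proof (cases "\<forall>j. r j = 0")
    case True
    then have "b j = (\<Sum>p\<in>P. b p * g p j)" for j
      unfolding r_def right_minus_eq by blast
    then have "v j = (\<Sum>p\<in>P. v p * g p j)" if "v \<in> insert b B" for v j
      using that rep by blast
    then show ?thesis
      by (intro exI[of _ P] exI[of _ g] conjI ballI allI) (rule P gV dual | assumption)+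
  next
    case False
    then obtain p0 where p0: "r p0 \<noteq> 0" by blast
    then have p0P: "p0 \<notin> P" using rP by blast
    define h where "h = vsmul (1 / r p0) (vadd b (vsmul (-1) (vsum (\<lambda>p. vsmul (b p) (g p)) P)))"
    have hj: "h j = r j / r p0" for j
      by (simp add: h_def vsmul_def vadd_def vsum_def r_def)
    have hV: "h \<in> V"
    proof -
      have "vsum (\<lambda>p. vsmul (b p) (g p)) P \<in> V"
        using csubsp_vsum[OF assms(1) P] gV assms(1) by (simp add: csubsp_def)
      then show ?thesis unfolding h_def using assms(1) insert.prems by (simp add: csubsp_def)
    qed
    \<comment> \<open>\<open>h\<close> is the error scaled to take the value \<open>1\<close> at
      \<open>p0\<close>; subtracting multiples of it makes the old functions vanish there without
      changing their values on \<open>P\<close>.\<close>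
    define g' where "g' p = (if p = p0 then h else vadd (g p) (vsmul (- g p p0) h))" for p
    have g': "g' p j = g p j - g p p0 * h j" if "p \<in> P" for p j
      using that p0P by (auto simp: g'_def vadd_def vsmul_def)
    \<comment> \<open>The new interpolation is the old one plus the old error at \<open>p0\<close>
      times \<open>h\<close>. That error is \<open>0\<close> for vectors of \<open>B\<close>, and
      for \<open>b\<close> the correction is exactly \<open>r\<close>.\<close>
    have expand: "(\<Sum>p\<in>insert p0 P. v p * g' p j) = (\<Sum>p\<in>P. v p * g p j) + (v p0 - (\<Sum>p\<in>P. v p * g p p0)) * h j"
      for v j
    proof -
      have "(\<Sum>p\<in>P. v p * g' p j) = (\<Sum>p\<in>P. v p * g p j) - (\<Sum>p\<in>P. v p * g p p0) * h j"
        unfolding sum_distrib_right sum_subtractf[symmetric]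
        by (intro sum.cong refl) (simp add: g' right_diff_distrib mult.assoc)
      then show ?thesis using P p0P by (simp add: g'_def[of p0] algebra_simps)
    qed
    show ?thesis
    proof (intro exI[of _ "insert p0 P"] exI[of _ g'] conjI ballI allI)
      show "finite (insert p0 P)" using P by simp
    next
      fix p assume "p \<in> insert p0 P"
      then show "g' p \<in> V" using gV hV assms(1) by (auto simp: g'_def csubsp_def)
    next
      fix p p' assume pp: "p \<in> insert p0 P" "p' \<in> insert p0 P"
      have h0: "h p0 = 1" using p0 by (simp add: hj)
      have hP: "h p = 0" if "p \<in> P" for p using rP[OF that] by (simp add: hj)
      show "g' p p' = (if p' = p then 1 else 0)"
        using pp p0P by (cases "p = p0"; cases "p' = p0") (auto simp: g'_def[of p0] h0 hP g' dual)
    next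
      fix v j assume "v \<in> insert b B"
      then consider "v = b" | "v \<in> B" by blast
      then show "v j = (\<Sum>p\<in>insert p0 P. v p * g' p j)"
      proof cases
        case 1
        have "(b p0 - (\<Sum>p\<in>P. b p * g p p0)) * h j = r j" using p0 by (simp add: hj r_def[of p0, symmetric])
        then have "(\<Sum>p\<in>insert p0 P. b p * g' p j) = (\<Sum>p\<in>P. b p * g p j) + r j"
          unfolding expand by (simp only:)
        then show ?thesis unfolding 1 r_def by simp
      next
        case 2
        then show ?thesis
          unfolding expand rep[OF 2, of p0, symmetric] rep[OF 2, of j, symmetric] by simp
      qed
    qed
  qed
qed

text \<open>The interpolation formula is linear in \<open>v\<close>, so it passes from a spanning
  set to the span.\<close>

lemma fin_dim_interpolation:
  assumes "csubsp V" "fin_dim V"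
  obtains P g where "finite P" "\<And>p. p \<in> P \<Longrightarrow> g p \<in> V"
    "\<And>v j. v \<in> V \<Longrightarrow> v j = (\<Sum>p\<in>P. v p * g p j)"
proof -
  obtain B where B: "finite B" "V = cspan B" using assms(2) by (auto simp: fin_dim_def)
  have "b \<in> cspan B" if "b \<in> B" for b
    unfolding cspan_def using that
    by (intro CollectI exI[of _ "{b}"] exI[of _ "\<lambda>_. 1"]) (auto simp: vsum_def vsmul_def)
  then have "B \<subseteq> V" using B by blast
  from interpolation_points[OF assms(1) B(1) this]
  obtain P g where P: "finite P" "\<forall>p\<in>P. g p \<in> V"
    and "\<forall>p\<in>P. \<forall>p'\<in>P. g p p' = (if p' = p then 1 else 0)"
    and rep: "\<forall>v\<in>B. \<forall>j. v j = (\<Sum>p\<in>P. v p * g p j)"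
    by blast
  have rep': "v j = (\<Sum>p\<in>P. v p * g p j)" if "v \<in> V" for v j
  proof -
    from that[unfolded B(2) cspan_def]
    obtain T c where T: "T \<subseteq> B" and v: "v = vsum (\<lambda>s. vsmul (c s) s) T"
      by auto
    have vj: "v j = (\<Sum>s\<in>T. c s * s j)" for j unfolding v vsum_def vsmul_def ..
    have "v j = (\<Sum>s\<in>T. c s * (\<Sum>p\<in>P. s p * g p j))"
      unfolding vj
      by (intro sum.cong refl arg_cong2[of _ _ _ _ "(*)"] rep[rule_format]) (use T in blast)
    also have "\<dots> = (\<Sum>p\<in>P. \<Sum>s\<in>T. c s * s p * g p j)"
      unfolding sum_distrib_left mult.assoc by (rule sum.swap)
    also have "\<dots> = (\<Sum>p\<in>P. v p * g p j)" unfolding vj sum_distrib_right ..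
    finally show ?thesis .
  qed
  show ?thesis
  proof (rule that[of P g])
    show "g p \<in> V" if "p \<in> P" for p using P(2) that by blast
    show "v j = (\<Sum>p\<in>P. v p * g p j)" if "v \<in> V" for v j by (rule rep'[OF that])
  qed (rule P(1))
qed

lemma fin_dim_periodic_space: "fin_dim periodic_space"
proof -
  define b :: "nat \<Rightarrow> vec" where "b c = (\<lambda>j. if j mod 5 = c then 1 else 0)" for c
  have bF: "b c \<in> periodic_space" for c by (simp add: b_def periodic_space_def)
  have inj: "inj_on b {..<5}"
  proof (rule inj_onI)
    fix c d :: nat assume "c \<in> {..<5}" "b c = b d"
    then have "b d c = 1" by (metis b_def lessThan_iff mod_less)
    then show "c = d" using \<open>c \<in> {..<5}\<close> by (simp add: b_def split: if_splits)
  qed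
  have "periodic_space = cspan (b ` {..<5})"
  proof
    show "cspan (b ` {..<5}) \<subseteq> periodic_space"
    proof
      fix v assume "v \<in> cspan (b ` {..<5})"
      then obtain T c where T: "finite T" "T \<subseteq> b ` {..<5}" and v: "v = vsum (\<lambda>s. vsmul (c s) s) T"
        unfolding cspan_def by blast
      show "v \<in> periodic_space"
        unfolding v by (rule csubsp_vsum[OF csubsp_periodic_space T(1)]) (use T(2) bF csubsp_periodic_space in \<open>auto simp: csubsp_def\<close>)
    qed
    show "periodic_space \<subseteq> cspan (b ` {..<5})"
    proof
      fix v assume v: "v \<in> periodic_space"
      then have per: "v j = v (j mod 5)" for j unfolding periodic_space_def by blast
      \<comment> \<open>\<open>cspan\<close> indexes coefficients by the vectors themselves, so the
        coefficient must be a function of \<open>s\<close>; \<open>\<Sum>d<5. v d * s d\<close>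
        takes the value \<open>v c\<close> at \<open>b c\<close>.\<close>
      have coef: "(\<Sum>d<5. v d * b c d) = v c" if "c < 5" for c
      proof -
        have "(\<Sum>d<5. v d * b c d) = (\<Sum>d<5. if d = c then v d else 0)"
          by (intro sum.cong) (auto simp: b_def)
        then show ?thesis using that by simp
      qed
      have "v j = vsum (\<lambda>s. vsmul (\<Sum>d<5. v d * s d) s) (b ` {..<5}) j" for j
      proof -
        have "vsum (\<lambda>s. vsmul (\<Sum>d<5. v d * s d) s) (b ` {..<5}) j = (\<Sum>c<5. v c * b c j)"
          unfolding vsum_def vsmul_def sum.reindex[OF inj] by (intro sum.cong) (auto simp: coef)
        also have "\<dots> = (\<Sum>c<5. if c = j mod 5 then v c else 0)"
          by (intro sum.cong) (auto simp: b_def)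
        also have "\<dots> = v (j mod 5)" by simp
        also have "\<dots> = v j" by (rule per[symmetric])
        finally show ?thesis by simp
      qed
      then have "v = vsum (\<lambda>s. vsmul (\<Sum>d<5. v d * s d) s) (b ` {..<5})" by (rule ext)
      then show "v \<in> cspan (b ` {..<5})"
        unfolding cspan_def mem_Collect_eq
        by (intro exI[of _ "b ` {..<5}"] exI[of _ "\<lambda>s. \<Sum>d<5. v d * s d"] conjI finite_imageI finite_lessThan
            subset_refl)
    qed
  qed
  then show ?thesis
    unfolding fin_dim_def by (intro exI[of _ "b ` {..<5}"] conjI finite_imageI finite_lessThan)
qed

section \<open>Failure of finite-dimensional lifting\<close>

text \<open>Matrix levels are numbers, so the torus points are numbered by \<open>e\<close>, with
  inverse \<open>d\<close>; functions on the points become vectors of length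
  \<open>n\<close>.\<close>

locale enumerated_torus_pts =
  fixes l n :: nat and e :: "nat \<Rightarrow> int \<times> int" and d :: "int \<times> int \<Rightarrow> nat"
  assumes e: "bij_betw e {..<n} (torus_pts l)" and d: "\<And>a. a < n \<Longrightarrow> d (e a) = a"
begin

lemma
  assumes "t \<in> torus_pts l"
  shows e_d: "e (d t) = t" and d_less: "d t < n"
proof -
  obtain a where "a < n" "t = e a" using assms e unfolding bij_betw_def by blast
  then show "e (d t) = t" "d t < n" by (simp_all add: d)
qed

lemma e_in: "a < n \<Longrightarrow> e a \<in> torus_pts l"
  using e by (auto simp: bij_betw_def)

lemma shear_in: "a < n \<Longrightarrow> shear l c (e a) \<in> torus_pts l"
  using e_in shear_bij[of l c] by (auto simp: bij_betw_def)

lemma sum_delta: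
  assumes "t \<in> torus_pts l"
  shows "(\<Sum>b<n. if e b = t then f b else (0::complex)) = f (d t)"
proof -
  have "(\<Sum>b<n. if e b = t then f b else 0) = (\<Sum>b<n. if b = d t then f b else 0)"
    using e_d[OF assms] d by (intro sum.cong) auto
  then show ?thesis using d_less[OF assms] by simp
qed

text \<open>Coordinate \<open>c\<close> of the entries forms the entrywise conjugate of the unitary
  with index \<open>c\<close> of level \<open>l\<close>, in the basis numbered by \<open>e\<close>;
  repetition with period \<open>5\<close> makes this a matrix over
  \<open>periodic_space\<close>.\<close>

definition test_mat :: "vec mat" where
  "test_mat a b = (if a < n \<and> b < n then
     (\<lambda>j. if e b = shear l (j mod 5) (e a) then cnj (phase l (j mod 5) (e a)) else 0) else vzero)"

lemma test_mat_in: "test_mat \<in> matset periodic_space n n"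
  by (auto simp: matset_def test_mat_def periodic_space_def)

lemma test_mat_entry:
  assumes "a < n" "b < n" "c < 5"
  shows "test_mat a b (5 * k + c) = (if e b = shear l c (e a) then cnj (phase l c (e a)) else 0)"
  using assms by (simp add: test_mat_def)

text \<open>For \<open>i < 5\<close> a single unitary appears, and \<open>1\<close> is below
  \<open>5 - spectral_gap\<close>. For \<open>i = 5\<close> the numbering turns the operator into
  the sum of tensor products of level \<open>k\<close> with conjugates of level \<open>l\<close>, to
  which \<open>l2_phase_shear_le\<close> applies.\<close>

lemma block_seminorm_test_mat_le:
  assumes "l < k" "i \<le> 5"
  shows "block_seminorm k i n test_mat \<le> 5 - spectral_gap"
proof -
  have 5: "0 \<le> 5 - spectral_gap" using spectral_gap_bounds by simp
  have act: "act ({..<n} \<times> S) (\<lambda>z w. wrep C h g k (test_mat (fst z) (fst w)) (snd z) (snd w)) u (a, s)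
    = (\<Sum>c\<in>C. g c s * cnj (phase l c (e a)) * u (d (shear l c (e a)), h c s))"
    if S: "finite S" "\<And>c. c \<in> C \<Longrightarrow> bij_betw (h c) S S" "s \<in> S" and C: "C \<subseteq> {..<5}" and a: "a < n"
    for S :: "(int \<times> int) set" and C h g u s a
  proof -
    have "(\<Sum>b<n. g c s * test_mat a b (5 * k + c) * u (b, h c s))
      = g c s * cnj (phase l c (e a)) * u (d (shear l c (e a)), h c s)" if "c \<in> C" for c
    proof -
      have "(\<Sum>b<n. g c s * test_mat a b (5 * k + c) * u (b, h c s))
        = (\<Sum>b<n. if e b = shear l c (e a) then g c s * cnj (phase l c (e a)) * u (b, h c s) else 0)"
        using that C a by (intro sum.cong) (auto simp: test_mat_entry)
      then show ?thesis by (simp add: sum_delta[OF shear_in[OF a]])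
    qed
    moreover have "act ({..<n} \<times> S) (\<lambda>z w. wrep C h g k (test_mat (fst z) (fst w)) (snd z) (snd w)) u (a, s)
      = (\<Sum>b<n. \<Sum>c\<in>C. g c s * test_mat a b (5 * k + c) * u (b, h c s))"
      by (rule act_wrep) (use S in auto)
    ultimately show ?thesis by (subst (asm) sum.swap) simp
  qed
  show ?thesis
  proof (cases "i < 5")
    case True
    let ?S = "{(0::int, 0::int)}"
    let ?T = "\<lambda>z w. wrep {i} (\<lambda>_ s. s) (\<lambda>_ _. 1) k (test_mat (fst z) (fst w)) (snd z) (snd w)"
    have "op_norm ({..<n} \<times> ?S) ({..<n} \<times> ?S) ?T \<le> 5 - spectral_gap"
    proof (rule op_norm_le[OF 5])
      fix u :: "nat \<times> int \<times> int \<Rightarrow> complex"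
      define \<pi> where "\<pi> a = d (shear l i (e a))" for a
      have \<pi>: "bij_betw \<pi> {..<n} {..<n}"
      proof -
        have "inj_on \<pi> {..<n}"
        proof (rule inj_onI)
          fix a b assume ab: "a \<in> {..<n}" "b \<in> {..<n}" "\<pi> a = \<pi> b"
          then have "shear l i (e a) = shear l i (e b)" using e_d[OF shear_in] by (metis \<pi>_def lessThan_iff)
          then have "e a = e b" using shear_bij[of l i] e_in ab by (auto simp: bij_betw_def inj_on_def)
          then show "a = b" using ab d by (metis lessThan_iff)
        qed
        moreover have "\<pi> ` {..<n} \<subseteq> {..<n}" using d_less[OF shear_in] by (auto simp: \<pi>_def)
        ultimately show ?thesis using endo_inj_surj[of "{..<n}" \<pi>] by (simp add: bij_betw_def)
      qed
      have "act ({..<n} \<times> ?S) ?T u (a, (0, 0)) = cnj (phase l i (e a)) * u (\<pi> a, (0, 0))" if "a < n" for a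
        using act[of ?S "{i}" "\<lambda>_ s. s" "(0, 0)" a "\<lambda>_ _. 1" u] that True by (simp add: \<pi>_def bij_betw_def)
      then have "l2 (act ({..<n} \<times> ?S) ?T u) ({..<n} \<times> ?S) = sqrt (\<Sum>a<n. (cmod (u (\<pi> a, (0, 0))))\<^sup>2)"
        by (simp add: L2_set_def sum.cartesian_product' norm_mult cmod_phase)
      also have "\<dots> = l2 u ({..<n} \<times> ?S)"
        using sum.reindex_bij_betw[OF \<pi>, of "\<lambda>a. (cmod (u (a, (0, 0))))\<^sup>2"]
        by (simp add: L2_set_def sum.cartesian_product')
      also have "\<dots> \<le> (5 - spectral_gap) * l2 u ({..<n} \<times> ?S)"
        using mult_right_mono[of 1 "5 - spectral_gap" "l2 u ({..<n} \<times> ?S)"] spectral_gap_bounds by simp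
      finally show "l2 (act ({..<n} \<times> ?S) ?T u) ({..<n} \<times> ?S) \<le> (5 - spectral_gap) * l2 u ({..<n} \<times> ?S)" .
    qed
    then show ?thesis using True by (simp add: block_seminorm_def rep_norm_def)
  next
    case False
    let ?T = "\<lambda>z w. wrep {..<5} (shear k) (phase k) k (test_mat (fst z) (fst w)) (snd z) (snd w)"
    let ?I = "{..<n} \<times> torus_pts k"
    have "op_norm ?I ?I ?T \<le> 5 - spectral_gap"
    proof (rule op_norm_le[OF 5])
      fix u :: "nat \<times> int \<times> int \<Rightarrow> complex"
      define f where "f z = u (d (snd z), fst z)" for z
      define F where "F z = (\<Sum>c<5. phase k c (fst z) * cnj (phase l c (snd z)) * f (shear k c (fst z), shear l c (snd z)))" for z
      \<comment> \<open>The numbering and a swap of factors identify vectors indexed by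
        \<open>?I\<close> with functions on pairs of torus points.\<close>
      have bij: "bij_betw (\<lambda>z. (snd z, e (fst z))) ?I (torus_pts k \<times> torus_pts l)"
        by (rule bij_betw_byWitness[where f' = "\<lambda>z. (d (snd z), fst z)"]) (auto simp: e_in d e_d d_less)
      have l2eq: "l2 (\<lambda>z. G (snd z, e (fst z))) ?I = l2 G (torus_pts k \<times> torus_pts l)" for G
        unfolding L2_set_def using sum.reindex_bij_betw[OF bij, of "\<lambda>z. (cmod (G z))\<^sup>2"] by simp
      have "act ?I ?T u z = F (snd z, e (fst z))" if "z \<in> ?I" for z
        using act[of "torus_pts k" "{..<5}" "shear k" "snd z" "fst z" "phase k" u] that
        by (auto simp: finite_torus_pts shear_bij F_def f_def)
      then have "l2 (act ?I ?T u) ?I = l2 (\<lambda>z. F (snd z, e (fst z))) ?I"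
        by (intro L2_set_cong) auto
      also have "\<dots> = l2 F (torus_pts k \<times> torus_pts l)" by (rule l2eq)
      also have "\<dots> \<le> (5 - spectral_gap) * l2 f (torus_pts k \<times> torus_pts l)"
        unfolding F_def by (rule l2_phase_shear_le[OF assms(1)])
      also have "l2 f (torus_pts k \<times> torus_pts l) = l2 (\<lambda>z. f (snd z, e (fst z))) ?I" by (rule l2eq[symmetric])
      also have "\<dots> = l2 u ?I" by (intro L2_set_cong) (auto simp: f_def d)
      finally show "l2 (act ?I ?T u) ?I \<le> (5 - spectral_gap) * l2 u ?I" .
    qed
    then show ?thesis using False by (simp add: block_seminorm_def rep_norm_def)
  qed
qed

text \<open>The tail from \<open>Suc l\<close> on avoids block \<open>l\<close>, where by
  \<open>block_seminorm_ge\<close> the seminorm is at least \<open>5\<close>.\<close>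

lemma limit_norm_test_mat_le: "limit_norm n test_mat \<le> 5 - spectral_gap"
proof -
  have "test_mat \<in> matset conv_space n n" using test_mat_in periodic_space_subset_conv_space matset_mono by blast
  then have "limit_norm n test_mat \<le> tail_norm (Suc l) n test_mat" by (rule limit_norm_le_tail_norm)
  also have "\<dots> \<le> 5 - spectral_gap" by (intro tail_norm_le block_seminorm_test_mat_le) auto
  finally show ?thesis .
qed

text \<open>Tested against the unnormalised maximally entangled vector \<open>\<Sum>\<^sub>a \<delta>\<^sub>a \<otimes> \<delta>\<^bsub>e a\<^esub>\<close>.\<close>

lemma sum_diagonal_le_block_seminorm:
  "cmod (\<Sum>a<n. \<Sum>c<5. phase l c (e a) * x a (d (shear l c (e a))) (5 * l + c)) \<le> real n * block_seminorm l 5 n x"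
proof -
  let ?I = "{..<n} \<times> torus_pts l"
  let ?T = "\<lambda>z w. wrep {..<5} (shear l) (phase l) l (x (fst z) (fst w)) (snd z) (snd w)"
  define \<omega> :: "nat \<times> int \<times> int \<Rightarrow> complex" where "\<omega> z = (if snd z = e (fst z) then 1 else 0)" for z
  have "(l2 \<omega> ?I)\<^sup>2 = (\<Sum>a<n. \<Sum>s\<in>torus_pts l. (cmod (\<omega> (a, s)))\<^sup>2)"
    by (simp add: L2_set_def sum_nonneg sum.cartesian_product case_prod_beta)
  also have "\<dots> = (\<Sum>a<n. \<Sum>s\<in>torus_pts l. if s = e a then 1 else 0)"
    by (intro sum.cong refl) (simp add: \<omega>_def)
  also have "\<dots> = real n" using e_in by (simp add: finite_torus_pts)
  finally have norm: "l2 \<omega> ?I * l2 \<omega> ?I = real n" by (simp add: power2_eq_square)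
  have row: "act ?I ?T \<omega> (a, e a) = (\<Sum>c<5. phase l c (e a) * x a (d (shear l c (e a))) (5 * l + c))" if a: "a < n" for a
  proof -
    have "act ?I ?T \<omega> (a, e a) = (\<Sum>b<n. \<Sum>c<5. phase l c (e a) * x a b (5 * l + c) * \<omega> (b, shear l c (e a)))"
      by (rule act_wrep) (auto simp: finite_torus_pts shear_bij e_in a)
    also have "\<dots> = (\<Sum>c<5. \<Sum>b<n. if e b = shear l c (e a) then phase l c (e a) * x a b (5 * l + c) else 0)"
      by (subst sum.swap) (auto simp: \<omega>_def intro!: sum.cong)
    also have "\<dots> = (\<Sum>c<5. phase l c (e a) * x a (d (shear l c (e a))) (5 * l + c))"
      by (simp add: sum_delta[OF shear_in[OF a]])
    finally show ?thesis .
  qed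
  have "(\<Sum>z\<in>?I. \<omega> z * act ?I ?T \<omega> z) = (\<Sum>a<n. \<Sum>s\<in>torus_pts l. if s = e a then act ?I ?T \<omega> (a, s) else 0)"
    unfolding sum.cartesian_product' by (intro sum.cong refl) (simp add: \<omega>_def)
  also have "\<dots> = (\<Sum>a<n. \<Sum>c<5. phase l c (e a) * x a (d (shear l c (e a))) (5 * l + c))"
    using e_in row by (simp add: finite_torus_pts)
  finally have "cmod (\<Sum>a<n. \<Sum>c<5. phase l c (e a) * x a (d (shear l c (e a))) (5 * l + c))
    \<le> l2 \<omega> ?I * l2 (act ?I ?T \<omega>) ?I"
    using cmod_sum_mult_le_l2[of \<omega> "act ?I ?T \<omega>" ?I] by simp
  also have "\<dots> \<le> l2 \<omega> ?I * (op_norm ?I ?I ?T * l2 \<omega> ?I)"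
    by (intro mult_left_mono l2_act_le_op_norm) (auto simp: finite_torus_pts)
  also have "\<dots> = real n * block_seminorm l 5 n x"
    using norm by (simp add: block_seminorm_def rep_norm_def mult_ac)
  finally show ?thesis .
qed

text \<open>At the positions picked out by the diagonal sum, \<open>test_mat\<close> cancels the
  phase, so each of the \<open>5 * n\<close> summands is within \<open>\<theta>\<close> of
  \<open>1\<close>.\<close>

lemma block_seminorm_ge:
  assumes err: "\<And>a b c. a < n \<Longrightarrow> b < n \<Longrightarrow> c < 5 \<Longrightarrow> cmod (x a b (5 * l + c) - test_mat a b c) \<le> \<theta>"
    and n: "n \<noteq> 0"
  shows "5 - 5 * \<theta> \<le> block_seminorm l 5 n x"
proof -
  let ?\<pi> = "\<lambda>c a. d (shear l c (e a))"
  define \<Sigma> where "\<Sigma> = (\<Sum>a<n. \<Sum>c<5. phase l c (e a) * x a (?\<pi> c a) (5 * l + c))"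
  have entry: "cmod (phase l c (e a) * x a (?\<pi> c a) (5 * l + c) - 1) \<le> \<theta>" if "a < n" "c < 5" for a c
  proof -
    have m: "?\<pi> c a < n" "e (?\<pi> c a) = shear l c (e a)" using d_less e_d shear_in that by auto
    have "phase l c (e a) * test_mat a (?\<pi> c a) c = 1"
      using test_mat_entry[OF that(1) m(1) that(2), of 0] m(2)
      by (simp add: complex_norm_square[symmetric] cmod_phase)
    then have "phase l c (e a) * x a (?\<pi> c a) (5 * l + c) - 1
      = phase l c (e a) * (x a (?\<pi> c a) (5 * l + c) - test_mat a (?\<pi> c a) c)"
      by (simp add: algebra_simps)
    then show ?thesis using err[OF that(1) m(1) that(2)] by (simp add: norm_mult cmod_phase)
  qed
  have "\<Sigma> - of_nat (5 * n) = (\<Sum>a<n. \<Sum>c<5. phase l c (e a) * x a (?\<pi> c a) (5 * l + c) - 1)"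
    by (simp add: \<Sigma>_def sum_subtractf)
  also have "cmod \<dots> \<le> (\<Sum>a<n. \<Sum>c<5::nat. \<theta>)"
    by (intro order_trans[OF norm_sum] sum_mono entry) auto
  also have "\<dots> = real n * (5 * \<theta>)" by simp
  finally have "cmod (\<Sigma> - of_nat (5 * n)) \<le> real n * (5 * \<theta>)" .
  moreover have "real (5 * n) \<le> cmod \<Sigma> + cmod (\<Sigma> - of_nat (5 * n))"
    using norm_triangle_ineq4[of \<Sigma> "\<Sigma> - of_nat (5 * n)"] norm_of_nat[of "5 * n", where 'a = complex] by simp
  moreover have "cmod \<Sigma> \<le> real n * block_seminorm l 5 n x" unfolding \<Sigma>_def by (rule sum_diagonal_le_block_seminorm)
  ultimately have "real n * (5 - 5 * \<theta>) \<le> real n * block_seminorm l 5 n x" by (simp add: algebra_simps)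
  then show ?thesis using n by simp
qed

end

section \<open>Uniform convergence on finite-dimensional subspaces and the contradiction\<close>

lemma ex_enumerated_torus_pts: "\<exists>n e d. enumerated_torus_pts l n e d \<and> n \<ge> 1"
proof -
  obtain e where e: "bij_betw e {0..<card (torus_pts l)} (torus_pts l)"
    using ex_bij_betw_nat_finite[OF finite_torus_pts] by blast
  have "enumerated_torus_pts l (card (torus_pts l)) e (inv_into {..<card (torus_pts l)} e)"
    using e by unfold_locales (auto simp: atLeast0LessThan bij_betw_def inv_into_f_f)
  moreover have "card (torus_pts l) \<ge> 1"
    using torus_pts_nonempty[of l] finite_torus_pts[of l] by (simp add: Suc_le_eq card_gt_0_iff)
  ultimately show ?thesis by blast
qed

text \<open>All entries of a matrix over \<open>E0\<close> are recovered from finitely many coordinates, whence the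
  uniformity in the matrix level.\<close>

lemma fin_dim_uniform_convergence:
  assumes E0: "csubsp E0" "E0 \<subseteq> conv_space" "fin_dim E0" and \<theta>: "\<theta> > 0"
  shows "\<exists>k. \<forall>n x. x \<in> matset E0 n n \<longrightarrow> (\<forall>a<n. \<forall>b<n. \<forall>c<5.
    cmod (x a b (5 * k + c) - block_limit (x a b) c) \<le> \<theta> * tail_norm 0 n x)"
proof -
  obtain P g where P: "finite P" and g: "\<And>p. p \<in> P \<Longrightarrow> g p \<in> E0"
    and rep: "\<And>v j. v \<in> E0 \<Longrightarrow> v j = (\<Sum>p\<in>P. v p * g p j)"
    using fin_dim_interpolation[OF E0(1,3)] by blast
  \<comment> \<open>\<open>\<delta>\<close> measures the convergence of the finitely many
    \<open>g p\<close>, and depends on neither \<open>n\<close> nor \<open>x\<close>.\<close>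
  define \<delta> where "\<delta> k = (\<Sum>p\<in>P. \<Sum>c<5. cmod (g p (5 * k + c) - block_limit (g p) c))" for k
  have "\<delta> \<longlonglongrightarrow> (\<Sum>p\<in>P. \<Sum>c<5::nat. 0)"
    unfolding \<delta>_def
  proof (intro tendsto_sum tendsto_norm_zero)
    fix p c assume "p \<in> P" "c \<in> {..<5::nat}"
    then have "(\<lambda>k. g p (5 * k + c)) \<longlonglongrightarrow> block_limit (g p) c" using g E0(2) by (intro conv_space_tendsto) auto
    then show "(\<lambda>k. g p (5 * k + c) - block_limit (g p) c) \<longlonglongrightarrow> 0" by (simp add: LIM_zero)
  qed
  then have "\<delta> \<longlonglongrightarrow> 0" by simp
  from LIMSEQ_D[OF this \<theta>] obtain k where k: "norm (\<delta> k - 0) < \<theta>" by blast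
  have "cmod (x a b (5 * k + c) - block_limit (x a b) c) \<le> \<theta> * tail_norm 0 n x"
    if x: "x \<in> matset E0 n n" and ab: "a < n" "b < n" and c: "c < 5" for n x a b c
  proof -
    let ?v = "x a b"
    have v: "?v \<in> E0" using x ab by (simp add: matset_def)
    have xE: "x \<in> matset conv_space n n" by (rule matset_mono[OF E0(2) x])
    have "(\<lambda>k. \<Sum>p\<in>P. ?v p * g p (5 * k + c)) \<longlonglongrightarrow> (\<Sum>p\<in>P. ?v p * block_limit (g p) c)"
      using g E0(2) c by (intro tendsto_sum tendsto_mult_left conv_space_tendsto) auto
    then have "(\<lambda>k. ?v (5 * k + c)) \<longlonglongrightarrow> (\<Sum>p\<in>P. ?v p * block_limit (g p) c)"
      unfolding rep[OF v, of "5 * _ + c"] .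
    moreover have "(\<lambda>k. ?v (5 * k + c)) \<longlonglongrightarrow> block_limit ?v c" using v E0(2) c by (intro conv_space_tendsto) auto
    ultimately have lim: "block_limit ?v c = (\<Sum>p\<in>P. ?v p * block_limit (g p) c)" using LIMSEQ_unique by blast
    have "?v (5 * k + c) - block_limit ?v c = (\<Sum>p\<in>P. ?v p * (g p (5 * k + c) - block_limit (g p) c))"
      unfolding lim rep[OF v, of "5 * k + c"] by (simp add: right_diff_distrib sum_subtractf)
    also have "cmod \<dots> \<le> (\<Sum>p\<in>P. cmod (?v p) * cmod (g p (5 * k + c) - block_limit (g p) c))"
      by (rule order_trans[OF norm_sum]) (simp add: norm_mult)
    \<comment> \<open>The coefficients \<open>?v p\<close> are coordinates of an entry of
      \<open>x\<close>, so the norm of \<open>x\<close> bounds them.\<close>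
    also have "\<dots> \<le> (\<Sum>p\<in>P. tail_norm 0 n x * (\<Sum>c<5. cmod (g p (5 * k + c) - block_limit (g p) c)))"
      using c by (intro sum_mono mult_mono cmod_entry_le_tail_norm[OF xE ab] member_le_sum tail_norm_nonneg[OF xE]) auto
    also have "\<dots> = \<delta> k * tail_norm 0 n x" by (simp add: \<delta>_def sum_distrib_left mult.commute)
    also have "\<dots> \<le> \<theta> * tail_norm 0 n x" using k by (intro mult_right_mono tail_norm_nonneg[OF xE]) auto
    finally show ?thesis .
  qed
  then show ?thesis by (intro exI[of _ k] allI impI)
qed

text \<open>The level \<open>l\<close> is chosen after \<open>E0\<close>, and the test matrix after
  \<open>l\<close>. With \<open>g\<close> for \<open>spectral_gap\<close>, the lift has norm at most
  \<open>(1 + g/10) * (5 - g)\<close>, hence at most \<open>5 - g/2\<close>. In block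
  \<open>l\<close> its coordinates are within \<open>g/100 * 5\<close> of those of the test matrix,
  which forces norm at least \<open>5 - g/4\<close>.\<close>

lemma no_fin_dim_lifting:
  assumes E0: "csubsp E0" "E0 \<subseteq> conv_space" "fin_dim E0"
    and lift: "\<And>n y. n \<ge> 1 \<Longrightarrow> y \<in> matset periodic_space n n \<Longrightarrow>
      \<exists>x\<in>matset E0 n n. amp block_limit n x = y \<and> tail_norm 0 n x \<le> (1 + spectral_gap / 10) * limit_norm n y"
  shows False
proof -
  note gap = spectral_gap_bounds
  have "spectral_gap / 100 > 0" using gap by simp
  from fin_dim_uniform_convergence[OF E0 this] obtain l where
    l: "\<forall>n x. x \<in> matset E0 n n \<longrightarrow> (\<forall>a<n. \<forall>b<n. \<forall>c<5.
      cmod (x a b (5 * l + c) - block_limit (x a b) c) \<le> spectral_gap / 100 * tail_norm 0 n x)"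
    by (rule exE)
  obtain n e d where "enumerated_torus_pts l n e d" and n: "n \<ge> 1" using ex_enumerated_torus_pts by blast
  then interpret enumerated_torus_pts l n e d by simp
  obtain x where x: "x \<in> matset E0 n n" and q: "amp block_limit n x = test_mat"
    and "tail_norm 0 n x \<le> (1 + spectral_gap / 10) * limit_norm n test_mat"
    using lift[OF n test_mat_in] by blast
  moreover have "(1 + spectral_gap / 10) * limit_norm n test_mat \<le> (1 + spectral_gap / 10) * (5 - spectral_gap)"
    using gap by (intro mult_left_mono limit_norm_test_mat_le) auto
  moreover have "(1 + spectral_gap / 10) * (5 - spectral_gap) \<le> 5 - spectral_gap / 2"
    using gap by (simp add: algebra_simps)
  ultimately have up: "tail_norm 0 n x \<le> 5 - spectral_gap / 2" by linarith
  have "cmod (x a b (5 * l + c) - test_mat a b c) \<le> spectral_gap / 20" if "a < n" "b < n" "c < 5" for a b c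
  proof -
    have "test_mat a b = block_limit (x a b)" using that by (simp add: q[symmetric] amp_def)
    then have "cmod (x a b (5 * l + c) - test_mat a b c) \<le> spectral_gap / 100 * tail_norm 0 n x"
      using l[rule_format, OF x that] by simp
    also have "\<dots> \<le> spectral_gap / 100 * 5" using up gap by (intro mult_left_mono) auto
    finally show ?thesis by simp
  qed
  then have "5 - 5 * (spectral_gap / 20) \<le> block_seminorm l 5 n x" using n by (intro block_seminorm_ge) auto
  moreover have "block_seminorm l 5 n x \<le> tail_norm 0 n x"
    by (rule block_seminorm_le_tail_norm[OF matset_mono[OF E0(2) x]]) auto
  ultimately show False using up gap by simp
qed

theorem theorem2p10:
  shows "\<not> (\<forall>E NE F NF q.
            banach_operator_space E NE \<and> banach_operator_space F NF \<and>
            complete_quotient E NE F NF q \<longrightarrow>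
            (\<forall>F0 (\<epsilon>::real). csubsp F0 \<and> F0 \<subseteq> F \<and> fin_dim F0 \<and> \<epsilon> > 0 \<longrightarrow>
               (\<exists>E0. csubsp E0 \<and> E0 \<subseteq> E \<and> fin_dim E0 \<and> q ` E0 = F0 \<and>
                  (\<forall>n\<ge>1. \<forall>y\<in>matset F0 n n. \<exists>x\<in>matset E0 n n.
                     amp q n x = y \<and> NE n x \<le> (1 + \<epsilon>) * NF n y))))"
proof
  assume "\<forall>E NE F NF q.
            banach_operator_space E NE \<and> banach_operator_space F NF \<and>
            complete_quotient E NE F NF q \<longrightarrow>
            (\<forall>F0 (\<epsilon>::real). csubsp F0 \<and> F0 \<subseteq> F \<and> fin_dim F0 \<and> \<epsilon> > 0 \<longrightarrow>
               (\<exists>E0. csubsp E0 \<and> E0 \<subseteq> E \<and> fin_dim E0 \<and> q ` E0 = F0 \<and>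
                  (\<forall>n\<ge>1. \<forall>y\<in>matset F0 n n. \<exists>x\<in>matset E0 n n.
                     amp q n x = y \<and> NE n x \<le> (1 + \<epsilon>) * NF n y)))"
  \<comment> \<open>\<open>F0\<close> is the whole five-dimensional space \<open>F\<close>, and
    \<open>spectral_gap / 10\<close> is the value of \<open>\<epsilon>\<close> for which no
    \<open>E0\<close> exists.\<close>
  from this[rule_format, OF conjI[OF banach_conv_space conjI[OF banach_periodic_space complete_quotient_block_limit]],
      of periodic_space "spectral_gap / 10"]
  obtain E0 where "csubsp E0" "E0 \<subseteq> conv_space" "fin_dim E0"
    and "\<forall>n\<ge>1. \<forall>y\<in>matset periodic_space n n. \<exists>x\<in>matset E0 n n.
      amp block_limit n x = y \<and> tail_norm 0 n x \<le> (1 + spectral_gap / 10) * limit_norm n y"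
    using csubsp_periodic_space fin_dim_periodic_space spectral_gap_bounds by auto
  then show False using no_fin_dim_lifting[of E0] by blast
qed

end
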